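(* Let $\{G_n\}_{n\in\mathbb{N}}$ be a family of expanders, i.e. of $(\mathbb{R},2)$-anders. Then for every Banach space $X$ that is sphere equivalent to a uniformly curved Banach space and every $p\in(1,\infty)$, $\{G_n\}_n$ is a family of $(X,p)$-anders. If, moreover, $X$ is sphere equivalent to $\ell_2$, then $\{G_n\}_n$ is also a family of $(X,1)$-anders.
   Context: Graphs $G=(V,E)$ are finite, connected, undirected, possibly with multiple edges and self-loops, with at least two vertices; $E$ is the set of oriented edges. The degree of $v$ is the number of oriented edges $e=(v,w)\in E$ starting at $v$; $\Delta(G)$ is the maximal degree; $G$ carries the path metric, and $\mathrm{diam}(G)$ is its diameter. Banach spaces are nonzero; $\ell_2=\ell_2(\mathbb{N},\mathbb{C})$. For a Banach space $X$ and $p\in[1,\infty)$, the $(X,p)$-spectral gap is $$\lambda_1(G;X,p):=\frac12\inf_{f}\frac{\sum_{v\in V}\sum_{e=(v,w)\in E}\|f(w)-f(v)\|^p}{\sum_{v\in V}\|f(v)-m(f)\|^p},\qquad m(f):=\frac1{|V|}\sum_{v\in V}f(v),$$ where $f$ runs over all nonconstant maps $f\colon V\to X$. A sequence $\{G_n\}_n$ of finite connected graphs is a family of $(X,p)$-anders if $\sup_n\Delta(G_n)<\infty$, $\lim_{n\to\infty}\mathrm{diam}(G_n)=\infty$, and $\inf_n\lambda_1(G_n;X,p)>0$. $S(X)$ denotes the unit sphere of $X$. Two Banach spaces $X,Y$ are sphere equivalent if there is a uniform homeomorphism $S(X)\to S(Y)$ (a bijection uniformly continuous in both directions). For a Banach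 space $X$ and $\epsilon>0$, let $\Lambda_X(\epsilon)$ be the infimum of those $\Lambda\in(0,\infty)$ such that for every $n\in\mathbb{N}$ and every $T=(t_{ij})\in \mathrm{M}_n(\mathbb{R})$ with $\|T\|_{L_2^n(\mathbb{R})\to L_2^n(\mathbb{R})}\le\epsilon$ and $\|\mathrm{abs}(T)\|_{L_2^n(\mathbb{R})\to L_2^n(\mathbb{R})}\le 1$, where $\mathrm{abs}(T)=(|t_{ij}|)$, one has $\|T\otimes I_X\|_{L_2^n(X)\to L_2^n(X)}\le\Lambda$. Here $L_2^n(X)$ is $X^n$ with the norm $(\frac1n\sum_{i=1}^n\|x_i\|^2)^{1/2}$. $X$ is uniformly curved if $\lim_{\epsilon\to+0}\Lambda_X(\epsilon)=0$. *)

theory Defs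
  imports
    "HOL-Analysis.Analysis"
    "Graph_Theory.Graph_Theory"
begin

section \<open>The Hilbert space of square-summable complex sequences\<close>

typedef ell2 = "{f :: nat \<Rightarrow> complex. summable (\<lambda>n. (cmod (f n))\<^sup>2)}"
  morphisms ell2_nth Abs_ell2
  by (rule exI[of _ "\<lambda>_. 0"]) simp

text \<open>
  Only the real vector space structure and the norm are set up; the inner product is the real part
  of the usual Hermitian one.
\<close>

setup_lifting type_definition_ell2

lemma ell2_summable: "summable (\<lambda>n. (cmod (ell2_nth x n))\<^sup>2)"
  using ell2_nth[of x] by simp

lemma ell2_eqI: "(\<And>n. ell2_nth x n = ell2_nth y n) \<Longrightarrow> x = y"
  by (metis ell2_nth_inject ext)

lemma cmod_add_square_le: "(cmod (a + b))\<^sup>2 \<le> 2 * (cmod a)\<^sup>2 + 2 * (cmod b)\<^sup>2"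
proof -
  have "(cmod (a + b))\<^sup>2 \<le> (cmod a + cmod b)\<^sup>2"
    by (intro power_mono norm_triangle_ineq) simp
  also have "\<dots> \<le> 2 * (cmod a)\<^sup>2 + 2 * (cmod b)\<^sup>2"
    using zero_le_power2[of "cmod a - cmod b"] by (simp add: power2_eq_square algebra_simps)
  finally show ?thesis .
qed

lemma square_summable_add:
  assumes "summable (\<lambda>n. (cmod (f n))\<^sup>2)" "summable (\<lambda>n. (cmod (g n))\<^sup>2)"
  shows "summable (\<lambda>n. (cmod (f n + g n))\<^sup>2)"
proof (rule summable_comparison_test')
  show "summable (\<lambda>n. 2 * (cmod (f n))\<^sup>2 + 2 * (cmod (g n))\<^sup>2)"
    by (intro summable_add summable_mult assms)
  show "norm ((cmod (f n + g n))\<^sup>2) \<le> 2 * (cmod (f n))\<^sup>2 + 2 * (cmod (g n))\<^sup>2" if "n \<ge> 0" for n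
    using cmod_add_square_le by simp
qed

lemma ell2_inner_summable: "summable (\<lambda>n. ell2_nth x n \<bullet> ell2_nth y n)"
proof (rule summable_comparison_test')
  show "summable (\<lambda>n. (cmod (ell2_nth x n))\<^sup>2 + (cmod (ell2_nth y n))\<^sup>2)"
    by (intro summable_add ell2_summable)
  show "norm (ell2_nth x n \<bullet> ell2_nth y n) \<le> (cmod (ell2_nth x n))\<^sup>2 + (cmod (ell2_nth y n))\<^sup>2"
    if "n \<ge> 0" for n
  proof -
    let ?a = "cmod (ell2_nth x n)" and ?b = "cmod (ell2_nth y n)"
    have nonneg: "0 \<le> ?a * ?b" by simp
    have "\<bar>ell2_nth x n \<bullet> ell2_nth y n\<bar> \<le> ?a * ?b"
      by (rule Cauchy_Schwarz_ineq2)
    also have "\<dots> \<le> ?a\<^sup>2 + ?b\<^sup>2"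
      using sum_squares_bound[of ?a ?b] nonneg by linarith
    finally show ?thesis by simp
  qed
qed

instantiation ell2 :: real_vector
begin

lift_definition zero_ell2 :: ell2 is "\<lambda>_. 0" by simp

lift_definition plus_ell2 :: "ell2 \<Rightarrow> ell2 \<Rightarrow> ell2" is "\<lambda>f g n. f n + g n"
  by (simp add: square_summable_add)

lift_definition uminus_ell2 :: "ell2 \<Rightarrow> ell2" is "\<lambda>f n. - f n" by simp

lift_definition minus_ell2 :: "ell2 \<Rightarrow> ell2 \<Rightarrow> ell2" is "\<lambda>f g n. f n - g n"
  subgoal for f g using square_summable_add[of f "\<lambda>n. - g n"] by simp
  done

lift_definition scaleR_ell2 :: "real \<Rightarrow> ell2 \<Rightarrow> ell2" is "\<lambda>r f n. r *\<^sub>R f n"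
  by (simp add: power_mult_distrib summable_mult)

instance
  by standard (transfer; simp add: fun_eq_iff algebra_simps)+

end

lemma ell2_nth_simps [simp]:
  "ell2_nth 0 n = 0"
  "ell2_nth (x + y) n = ell2_nth x n + ell2_nth y n"
  "ell2_nth (x - y) n = ell2_nth x n - ell2_nth y n"
  "ell2_nth (r *\<^sub>R x) n = r *\<^sub>R ell2_nth x n"
  by (transfer; simp)+

instantiation ell2 :: real_inner
begin

definition inner_ell2 :: "ell2 \<Rightarrow> ell2 \<Rightarrow> real"
  where "inner_ell2 x y = (\<Sum>n. ell2_nth x n \<bullet> ell2_nth y n)"

definition norm_ell2 :: "ell2 \<Rightarrow> real"
  where "norm_ell2 x = sqrt (\<Sum>n. (cmod (ell2_nth x n))\<^sup>2)"

definition dist_ell2 :: "ell2 \<Rightarrow> ell2 \<Rightarrow> real"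
  where "dist_ell2 x y = norm (x - y)"

definition sgn_ell2 :: "ell2 \<Rightarrow> ell2"
  where "sgn_ell2 x = x /\<^sub>R norm x"

definition uniformity_ell2 :: "(ell2 \<times> ell2) filter"
  where "uniformity_ell2 = (INF e\<in>{0<..}. principal {(x, y). dist x y < e})"

definition open_ell2 :: "ell2 set \<Rightarrow> bool"
  where "open_ell2 U = (\<forall>x\<in>U. eventually (\<lambda>(x', y). x' = x \<longrightarrow> y \<in> U) uniformity)"

instance
proof
  fix x y z :: ell2 and r :: real and U :: "ell2 set"
  show "dist x y = norm (x - y)" by (rule dist_ell2_def)
  show "sgn x = x /\<^sub>R norm x" by (rule sgn_ell2_def)
  show "uniformity = (INF e\<in>{0<..}. principal {(x :: ell2, y). dist x y < e})"
    by (rule uniformity_ell2_def)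
  show "open U \<longleftrightarrow> (\<forall>x\<in>U. eventually (\<lambda>(x', y). x' = x \<longrightarrow> y \<in> U) uniformity)"
    by (rule open_ell2_def)
  show "x \<bullet> y = y \<bullet> x"
    by (simp add: inner_ell2_def inner_commute)
  show "(x + y) \<bullet> z = x \<bullet> z + y \<bullet> z"
    by (simp add: inner_ell2_def inner_add_left suminf_add ell2_inner_summable)
  show "(r *\<^sub>R x) \<bullet> y = r * (x \<bullet> y)"
    using suminf_mult[OF ell2_inner_summable[of x y], of r] by (simp add: inner_ell2_def)
  show "0 \<le> x \<bullet> x"
    using ell2_inner_summable[of x x] by (simp add: inner_ell2_def suminf_nonneg)
  show "x \<bullet> x = 0 \<longleftrightarrow> x = 0"
    using suminf_eq_zero_iff[OF ell2_inner_summable[of x x]]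
    by (auto simp: inner_ell2_def intro: ell2_eqI)
  show "norm x = sqrt (x \<bullet> x)"
    by (simp add: norm_ell2_def inner_ell2_def power2_norm_eq_inner)
qed

end

lemma cmod_ell2_nth_le: "cmod (ell2_nth x n) \<le> norm x"
proof -
  have "(cmod (ell2_nth x n))\<^sup>2 \<le> (\<Sum>n. (cmod (ell2_nth x n))\<^sup>2)"
    using sum_le_suminf[OF ell2_summable[of x], of "{n}"] by simp
  then show ?thesis by (simp add: norm_ell2_def real_le_rsqrt)
qed

lemma ell2_partial_le: "(\<Sum>k<N. (cmod (ell2_nth x k))\<^sup>2) \<le> (norm x)\<^sup>2"
  using sum_le_suminf[OF ell2_summable[of x], of "{..<N}"]
  by (simp add: norm_ell2_def suminf_nonneg ell2_summable)

instance ell2 :: banach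
proof
  fix X :: "nat \<Rightarrow> ell2"
  assume X: "Cauchy X"
  have "Cauchy (\<lambda>m. ell2_nth (X m) k)" for k
    unfolding Cauchy_def dist_norm
  proof (intro allI impI)
    fix e :: real assume "e > 0"
    then obtain M where M: "\<And>m n. m \<ge> M \<Longrightarrow> n \<ge> M \<Longrightarrow> norm (X m - X n) < e"
      using X unfolding Cauchy_def dist_norm by blast
    show "\<exists>M. \<forall>m\<ge>M. \<forall>n\<ge>M. cmod (ell2_nth (X m) k - ell2_nth (X n) k) < e"
    proof (intro exI[of _ M] allI impI)
      fix m n assume "m \<ge> M" "n \<ge> M"
      then show "cmod (ell2_nth (X m) k - ell2_nth (X n) k) < e"
        using M[of m n] cmod_ell2_nth_le[of "X m - X n" k] by simp
    qed
  qed
  then have "\<exists>l. (\<lambda>m. ell2_nth (X m) k) \<longlonglongrightarrow> l" for k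
    by (simp add: Cauchy_convergent_iff convergent_def)
  then obtain f where f: "\<And>k. (\<lambda>m. ell2_nth (X m) k) \<longlonglongrightarrow> f k"
    by metis
  have part: "(\<Sum>k<N. (cmod (ell2_nth (X m) k - f k))\<^sup>2) \<le> e\<^sup>2"
    if M: "\<And>m n. m \<ge> M \<Longrightarrow> n \<ge> M \<Longrightarrow> norm (X m - X n) < e" and "m \<ge> M" for M m N e
  proof (rule tendsto_upperbound)
    show "(\<lambda>n. \<Sum>k<N. (cmod (ell2_nth (X m) k - ell2_nth (X n) k))\<^sup>2)
            \<longlonglongrightarrow> (\<Sum>k<N. (cmod (ell2_nth (X m) k - f k))\<^sup>2)"
      by (intro tendsto_intros f)
    show "\<forall>\<^sub>F n in sequentially. (\<Sum>k<N. (cmod (ell2_nth (X m) k - ell2_nth (X n) k))\<^sup>2) \<le> e\<^sup>2"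
    proof (rule eventually_sequentiallyI[of M])
      fix n assume "n \<ge> M"
      have "(\<Sum>k<N. (cmod (ell2_nth (X m) k - ell2_nth (X n) k))\<^sup>2) \<le> (norm (X m - X n))\<^sup>2"
        using ell2_partial_le[of "X m - X n" N] by simp
      also have "\<dots> \<le> e\<^sup>2"
        using M[OF \<open>m \<ge> M\<close> \<open>n \<ge> M\<close>] by (intro power_mono) auto
      finally show "(\<Sum>k<N. (cmod (ell2_nth (X m) k - ell2_nth (X n) k))\<^sup>2) \<le> e\<^sup>2" .
    qed
  qed simp
  have summ: "summable (\<lambda>k. (cmod (ell2_nth (X m) k - f k))\<^sup>2)"
    and bnd: "(\<Sum>k. (cmod (ell2_nth (X m) k - f k))\<^sup>2) \<le> e\<^sup>2"
    if M: "\<And>m n. m \<ge> M \<Longrightarrow> n \<ge> M \<Longrightarrow> norm (X m - X n) < e" and "m \<ge> M" for M m e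
  proof -
    show "summable (\<lambda>k. (cmod (ell2_nth (X m) k - f k))\<^sup>2)"
      by (rule summableI_nonneg_bounded[of _ "e\<^sup>2"]) (use part[OF M \<open>m \<ge> M\<close>] in auto)
    then show "(\<Sum>k. (cmod (ell2_nth (X m) k - f k))\<^sup>2) \<le> e\<^sup>2"
      by (rule suminf_le_const) (use part[OF M \<open>m \<ge> M\<close>] in auto)
  qed
  obtain M1 where M1: "\<And>m n. m \<ge> M1 \<Longrightarrow> n \<ge> M1 \<Longrightarrow> norm (X m - X n) < 1"
    using X unfolding Cauchy_def dist_norm by (meson zero_less_one)
  have "summable (\<lambda>k. (cmod (f k))\<^sup>2)"
    using square_summable_add[of "ell2_nth (X M1)" "\<lambda>k. - (ell2_nth (X M1) k - f k)"]
      ell2_summable[of "X M1"] summ[OF M1 order_refl]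
    by (simp add: norm_minus_commute)
  then have nth: "ell2_nth (Abs_ell2 f) = f"
    by (simp add: Abs_ell2_inverse)
  have "X \<longlonglongrightarrow> Abs_ell2 f"
    unfolding lim_sequentially dist_norm
  proof (intro allI impI)
    fix e :: real assume "e > 0"
    then obtain M where M: "\<And>m n. m \<ge> M \<Longrightarrow> n \<ge> M \<Longrightarrow> norm (X m - X n) < e / 2"
      using X unfolding Cauchy_def dist_norm by (meson half_gt_zero)
    have "norm (X m - Abs_ell2 f) < e" if "m \<ge> M" for m
    proof -
      have "norm (X m - Abs_ell2 f) \<le> sqrt ((e / 2)\<^sup>2)"
        unfolding norm_ell2_def ell2_nth_simps nth
        by (intro real_sqrt_le_mono bnd[OF M that])
      also have "\<dots> < e" using \<open>e > 0\<close> by simp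
      finally show ?thesis .
    qed
    then show "\<exists>M. \<forall>m\<ge>M. norm (X m - Abs_ell2 f) < e" by blast
  qed
  then show "convergent X" by (auto simp: convergent_def)
qed


section \<open>Graphs\<close>

text \<open>
  An undirected multigraph is presented by its oriented edges \<open>arcs G\<close>, together with an
  orientation reversal that witnesses that parallel edges occur with the same multiplicity in both
  directions. The reversal may fix a self-loop, so a self-loop may
  contribute either one or two oriented edges.
\<close>

definition finite_connected_graph :: "('v, 'e) pre_digraph \<Rightarrow> bool" where
  "finite_connected_graph G \<longleftrightarrow>
     fin_digraph G \<and>
     (\<exists>rev. \<forall>e\<in>arcs G. rev e \<in> arcs G \<and> rev (rev e) = e \<and>
        tail G (rev e) = head G e \<and> head G (rev e) = tail G e) \<and>
     Digraph_Component.connected G \<and>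
     card (verts G) \<ge> 2"

definition max_degree :: "('v, 'e) pre_digraph \<Rightarrow> nat" where
  "max_degree G = Max (out_degree G ` verts G)"

text \<open>The path metric is the shortest-path distance for the unit weight on edges.\<close>

definition graph_diam :: "('v, 'e) pre_digraph \<Rightarrow> ereal" where
  "graph_diam G = (SUP (u, v)\<in>verts G \<times> verts G. wf_digraph.\<mu> G (\<lambda>_. 1) u v)"

definition graph_mean :: "('v, 'e) pre_digraph \<Rightarrow> ('v \<Rightarrow> 'x::real_normed_vector) \<Rightarrow> 'x" where
  "graph_mean G f = (\<Sum>v\<in>verts G. f v) /\<^sub>R real (card (verts G))"

definition spectral_gap :: "'x::real_normed_vector itself \<Rightarrow> real \<Rightarrow> ('v, 'e) pre_digraph \<Rightarrow> real" where
  "spectral_gap _ p G =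
     1 / 2 * (INF f\<in>{f :: 'v \<Rightarrow> 'x. \<not> f constant_on verts G}.
       (\<Sum>v\<in>verts G. \<Sum>e\<in>out_arcs G v. norm (f (head G e) - f v) powr p) /
       (\<Sum>v\<in>verts G. norm (f v - graph_mean G f) powr p))"

definition anders :: "'x::real_normed_vector itself \<Rightarrow> real \<Rightarrow> (nat \<Rightarrow> ('v, 'e) pre_digraph) \<Rightarrow> bool" where
  "anders X p G \<longleftrightarrow>
     (\<forall>n. finite_connected_graph (G n)) \<and>
     bdd_above (range (\<lambda>n. max_degree (G n))) \<and>
     (\<lambda>n. graph_diam (G n)) \<longlonglongrightarrow> \<infinity> \<and>
     (INF n. spectral_gap X p (G n)) > 0"


section \<open>Banach spaces\<close>

text \<open>
  The notions below use only the norm and the real-linear structure, so a complex Banach space is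
  covered through its underlying real Banach space.
\<close>

definition sphere_equivalent ::
  "'x::real_normed_vector itself \<Rightarrow> 'y::real_normed_vector itself \<Rightarrow> bool" where
  "sphere_equivalent _ _ \<longleftrightarrow>
     (\<exists>\<phi> :: 'x \<Rightarrow> 'y. bij_betw \<phi> (sphere 0 1) (sphere 0 1) \<and>
        uniformly_continuous_on (sphere 0 1) \<phi> \<and>
        uniformly_continuous_on (sphere 0 1) (inv_into (sphere 0 1) \<phi>))"

text \<open>
  Elements of \<open>X\<^sup>n\<close> and \<open>n \<times> n\<close> matrices are functions of which only the values at indices
  below \<open>n\<close> matter.
\<close>

definition L2_norm :: "nat \<Rightarrow> (nat \<Rightarrow> 'x::real_normed_vector) \<Rightarrow> real" where
  "L2_norm n x = sqrt (1 / real n * (\<Sum>i<n. (norm (x i))\<^sup>2))"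

text \<open>
  The operator norm of \<open>T \<otimes> I\<^sub>X\<close> on \<open>L\<^sub>2\<^sup>n(X)\<close>, written like \<^const>\<open>onorm\<close> as a
  supremum of quotients, with value \<open>0\<close> when the denominator vanishes.
\<close>

definition L2_onorm :: "'x::real_normed_vector itself \<Rightarrow> nat \<Rightarrow> (nat \<Rightarrow> nat \<Rightarrow> real) \<Rightarrow> real" where
  "L2_onorm _ n T =
     (SUP x :: nat \<Rightarrow> 'x. L2_norm n (\<lambda>i. \<Sum>j<n. T i j *\<^sub>R x j) / L2_norm n x)"

definition curvature_modulus :: "'x::real_normed_vector itself \<Rightarrow> real \<Rightarrow> real" where
  "curvature_modulus X \<epsilon> =
     Inf {\<Lambda>. \<Lambda> > 0 \<and>
       (\<forall>n\<ge>1. \<forall>T. L2_onorm TYPE(real) n T \<le> \<epsilon> \<and>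
          L2_onorm TYPE(real) n (\<lambda>i j. \<bar>T i j\<bar>) \<le> 1 \<longrightarrow> L2_onorm X n T \<le> \<Lambda>)}"

definition uniformly_curved :: "'x::real_normed_vector itself \<Rightarrow> bool" where
  "uniformly_curved X \<longleftrightarrow> (curvature_modulus X \<longlongrightarrow> 0) (at_right 0)"

end

theory Submission
  imports Defs
begin

text \<open>
  A lower bound on \<open>\<lambda>\<^sub>1(G; X, p)\<close> is the same as a Poincare inequality
  \<open>c \<Sum>\<^sub>v \<parallel>f v - m(f)\<parallel>\<^sup>p \<le> \<Sum>\<^sub>e \<parallel>f(head e) - f(tail e)\<parallel>\<^sup>p\<close> for all \<open>f : V \<rightarrow> X\<close>
  (\<open>spectral_gap_ge_iff\<close>), so what is needed is a passage of this inequality, with constants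
  depending only on the degree bound \<open>D\<close> and not on the graph, from \<open>(\<real>, 2)\<close> to \<open>(Y, 2)\<close> and from there
  to \<open>(X, p)\<close>.

  From \<open>\<real>\<close> to a uniformly curved \<open>Y\<close> (\<open>uniformly_curved_poincare\<close>). Let \<open>A = I - L / (2 D)\<close>, with \<open>L\<close>
  the Laplacian, and let \<open>J\<close> average over the vertices. The matrix \<open>A\<close> is symmetric and
  doubly stochastic, and the scalar inequality makes it a strict contraction on real functions of
  mean zero. Hence \<open>A\<^sup>k - J\<close> has small norm on real functions for large \<open>k\<close>, whereas its matrix of
  absolute values has norm at most 2. Uniform curvature says exactly that such a matrix has small
  norm on \<open>Y\<close>-valued functions, so \<open>\<parallel>A\<^sup>k f\<parallel> \<le> \<parallel>f\<parallel> / 2\<close> for \<open>f\<close> of mean zero. Then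
  \<open>\<parallel>f\<parallel> \<le> 2 \<parallel>f - A\<^sup>k f\<parallel> \<le> 2 k \<parallel>f - A f\<parallel>\<close>, and \<open>f - A f = L f / (2 D)\<close> is controlled by the edge differences.
  For \<open>\<ell>\<^sub>2\<close> the inequality with exponent 2 is simply summed over coordinates (\<open>poincare_2_ell2\<close>).

  From \<open>(Y, q)\<close> to \<open>(X, p)\<close>, for any \<open>p, q \<ge> 1\<close> (\<open>sphere_equivalent_poincare\<close>). Extend the sphere
  homeomorphism \<open>\<phi>\<close> to \<open>\<Phi> x = \<parallel>x\<parallel>\<^bsup>p/q\<^esup> \<phi>(x / \<parallel>x\<parallel>)\<close>, so that \<open>\<parallel>\<Phi> x\<parallel>\<^sup>q = \<parallel>x\<parallel>\<^sup>p\<close>. Uniform continuity on the sphere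
  becomes the pointwise estimate
  \<open>\<parallel>\<Phi> x - \<Phi> y\<parallel>\<^sup>q \<le> \<eta> \<parallel>x\<parallel>\<^sup>p + C\<^sub>\<eta> \<parallel>x - y\<parallel>\<^sup>p\<close> for every \<open>\<eta> > 0\<close> (\<open>radial_extension_powr_estimate\<close>), which
  can be summed over vertices or edges and holds likewise for the inverse \<open>\<Psi>\<close>. If \<open>f\<close> has mean zero
  and small edge differences, then \<open>\<Phi> \<circ> f\<close> has small edge differences, hence is close to a constant
  \<open>b\<close>, hence \<open>f\<close> is close to the constant \<open>\<Psi> b\<close>; but a function of mean zero and norm 1 is not close to a constant.
\<close>

section \<open>Poincare inequalities and spectral gaps\<close>

text \<open>
  The edge differences are summed over all oriented edges at once, and the factor \<open>1 / 2\<close> of the spectral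
  gap is absorbed in \<open>c\<close>. Constant functions may be included, since both sides vanish for them.
\<close>
definition poincare :: "'x::real_normed_vector itself \<Rightarrow> real \<Rightarrow> real \<Rightarrow> ('v, 'e) pre_digraph \<Rightarrow> bool" where
  "poincare _ p c G \<longleftrightarrow> (\<forall>f :: 'v \<Rightarrow> 'x.
     c * (\<Sum>v\<in>verts G. norm (f v - graph_mean G f) powr p) \<le>
     (\<Sum>e\<in>arcs G. norm (f (head G e) - f (tail G e)) powr p))"

lemma finite_connected_graphD:
  assumes "finite_connected_graph G"
  shows "finite (verts G)" "finite (arcs G)" "verts G \<noteq> {}" "2 \<le> card (verts G)"
    "\<And>e. e \<in> arcs G \<Longrightarrow> tail G e \<in> verts G" "\<And>e. e \<in> arcs G \<Longrightarrow> head G e \<in> verts G"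
proof -
  interpret fin_digraph G using assms by (simp add: finite_connected_graph_def)
  show "finite (verts G)" "finite (arcs G)" by auto
  show c: "2 \<le> card (verts G)" using assms by (simp add: finite_connected_graph_def)
  then show "verts G \<noteq> {}" by auto
  show "\<And>e. e \<in> arcs G \<Longrightarrow> tail G e \<in> verts G" "\<And>e. e \<in> arcs G \<Longrightarrow> head G e \<in> verts G" by auto
qed

lemma sum_out_arcs:
  assumes "finite_connected_graph G"
  shows "(\<Sum>v\<in>verts G. \<Sum>e\<in>out_arcs G v. F v e) = (\<Sum>e\<in>arcs G. F (tail G e) e)"
proof -
  note fin = finite_connected_graphD[OF assms]
  have "(\<Sum>v\<in>verts G. \<Sum>e\<in>out_arcs G v. F v e)
      = (\<Sum>v\<in>verts G. \<Sum>e\<in>{e \<in> arcs G. tail G e = v}. F (tail G e) e)"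
    by (intro sum.cong) (auto simp: out_arcs_def)
  also have "\<dots> = (\<Sum>e\<in>arcs G. F (tail G e) e)"
    by (rule sum.group) (use fin in auto)
  finally show ?thesis .
qed

lemma sum_arcs_reverse:
  assumes "finite_connected_graph G"
  shows "(\<Sum>e\<in>arcs G. F (tail G e) (head G e)) = (\<Sum>e\<in>arcs G. F (head G e) (tail G e))"
proof -
  obtain r where r: "\<And>e. e \<in> arcs G \<Longrightarrow> r e \<in> arcs G \<and> r (r e) = e \<and>
        tail G (r e) = head G e \<and> head G (r e) = tail G e"
    using assms unfolding finite_connected_graph_def by blast
  show ?thesis
    by (rule sum.reindex_bij_witness[of _ r r]) (use r in auto)
qed

lemma not_constant_variance_pos:
  fixes f :: "'v \<Rightarrow> 'x::real_normed_vector"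
  assumes "finite_connected_graph G" "\<not> f constant_on verts G"
  shows "(\<Sum>v\<in>verts G. norm (f v - graph_mean G f) powr p) > 0"
proof -
  obtain v where v: "v \<in> verts G" "f v \<noteq> graph_mean G f"
    using assms(2) unfolding constant_on_def by blast
  show ?thesis
    by (rule sum_pos2[of _ v]) (use finite_connected_graphD[OF assms(1)] v in auto)
qed

lemma graph_mean_const:
  fixes f :: "'v \<Rightarrow> 'x::real_normed_vector"
  assumes "finite_connected_graph G" "\<And>v. v \<in> verts G \<Longrightarrow> f v = a"
  shows "graph_mean G f = a"
  using assms(2) finite_connected_graphD[OF assms(1)] by (simp add: graph_mean_def sum_constant_scaleR)

lemma graph_mean_diff:
  fixes f :: "'v \<Rightarrow> 'x::real_normed_vector"
  assumes "finite_connected_graph G"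
  shows "graph_mean G (\<lambda>v. f v - a) = graph_mean G f - a"
  using finite_connected_graphD[OF assms]
  by (simp add: graph_mean_def sum_subtractf scaleR_diff_right sum_constant_scaleR)

lemma exists_nonconstant:
  assumes "finite_connected_graph G" "(UNIV :: 'x::real_normed_vector set) \<noteq> {0}"
  shows "\<exists>f :: 'v \<Rightarrow> 'x. \<not> f constant_on verts G"
proof -
  obtain a :: 'x where a: "a \<noteq> 0" using assms(2) by auto
  have c: "2 \<le> card (verts G)" by (rule finite_connected_graphD[OF assms(1)])
  obtain u where u: "u \<in> verts G" using finite_connected_graphD[OF assms(1)] by auto
  have "verts G \<noteq> {u}" using c by auto
  then obtain v where v: "v \<in> verts G" "v \<noteq> u" using u by auto
  show ?thesis
    by (rule exI[of _ "\<lambda>w. if w = u then a else 0"])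
      (use u v a in \<open>auto simp: constant_on_def\<close>)
qed

lemma spectral_gap_ge_iff:
  fixes G :: "('v, 'e) pre_digraph"
  assumes G: "finite_connected_graph G" and ne: "(UNIV :: 'x::real_normed_vector set) \<noteq> {0}"
  shows "c \<le> spectral_gap TYPE('x) p G \<longleftrightarrow> poincare TYPE('x) p (2 * c) G"
proof -
  define N where "N f = (\<Sum>e\<in>arcs G. norm (f (head G e) - f (tail G e)) powr p)" for f :: "'v \<Rightarrow> 'x"
  define V where "V f = (\<Sum>v\<in>verts G. norm (f v - graph_mean G f) powr p)" for f :: "'v \<Rightarrow> 'x"
  let ?S = "{f :: 'v \<Rightarrow> 'x. \<not> f constant_on verts G}"
  have S: "?S \<noteq> {}" using exists_nonconstant[OF G ne] by auto
  have pos: "V f > 0" if "f \<in> ?S" for f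
    using not_constant_variance_pos[OF G, of f p] that by (simp add: V_def)
  have N0: "N f \<ge> 0" for f unfolding N_def by (intro sum_nonneg) auto
  have gap: "spectral_gap TYPE('x) p G = 1 / 2 * (INF f\<in>?S. N f / V f)"
    unfolding spectral_gap_def N_def V_def sum_out_arcs[OF G] ..
  have bdd: "bdd_below ((\<lambda>f. N f / V f) ` ?S)"
    by (rule bdd_belowI2[of _ 0]) (use N0 pos in \<open>auto intro!: divide_nonneg_nonneg intro: less_imp_le\<close>)
  have "c \<le> spectral_gap TYPE('x) p G \<longleftrightarrow> 2 * c \<le> (INF f\<in>?S. N f / V f)"
    unfolding gap by auto
  also have "\<dots> \<longleftrightarrow> (\<forall>f\<in>?S. 2 * c \<le> N f / V f)"
    by (rule le_cINF_iff[OF S bdd])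
  also have "\<dots> \<longleftrightarrow> (\<forall>f\<in>?S. 2 * c * V f \<le> N f)"
    by (intro ball_cong refl) (use pos in \<open>simp add: pos_le_divide_eq\<close>)
  also have "\<dots> \<longleftrightarrow> (\<forall>f. 2 * c * V f \<le> N f)"
  proof -
    have "2 * c * V f \<le> N f" if nc: "f \<notin> ?S" for f
    proof -
      obtain a where a: "\<And>v. v \<in> verts G \<Longrightarrow> f v = a"
        using nc unfolding constant_on_def by blast
      then have "V f = 0" using graph_mean_const[OF G, of f a] by (simp add: V_def)
      then show ?thesis using N0 by simp
    qed
    then show ?thesis by blast
  qed
  finally show ?thesis by (simp add: poincare_def N_def V_def)
qed

lemma anders_iff:
  fixes G :: "nat \<Rightarrow> ('v, 'e) pre_digraph"
  assumes ne: "(UNIV :: 'x::real_normed_vector set) \<noteq> {0}"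
  shows "anders TYPE('x) p G \<longleftrightarrow>
     (\<forall>n. finite_connected_graph (G n)) \<and>
     bdd_above (range (\<lambda>n. max_degree (G n))) \<and>
     (\<lambda>n. graph_diam (G n)) \<longlonglongrightarrow> \<infinity> \<and>
     (\<exists>c>0. \<forall>n. poincare TYPE('x) p c (G n))"
proof (cases "\<forall>n. finite_connected_graph (G n)")
  case True
  then have G: "finite_connected_graph (G n)" for n by simp
  let ?g = "\<lambda>n. spectral_gap TYPE('x) p (G n)"
  have "0 \<le> ?g n" for n
    unfolding spectral_gap_ge_iff[OF G ne] by (auto simp: poincare_def intro!: sum_nonneg)
  then have bdd: "bdd_below (range ?g)" by (auto intro!: bdd_belowI2[of _ 0])
  have "(INF n. ?g n) > 0 \<longleftrightarrow> (\<exists>c>0. \<forall>n. poincare TYPE('x) p c (G n))"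
  proof
    assume pos: "(INF n. ?g n) > 0"
    have "(INF n. ?g n) \<le> ?g n" for n by (rule cINF_lower[OF bdd]) simp
    then have "poincare TYPE('x) p (2 * (INF n. ?g n)) (G n)" for n
      unfolding spectral_gap_ge_iff[OF G ne] .
    then show "\<exists>c>0. \<forall>n. poincare TYPE('x) p c (G n)"
      using pos by (intro exI[of _ "2 * (INF n. ?g n)"]) auto
  next
    assume "\<exists>c>0. \<forall>n. poincare TYPE('x) p c (G n)"
    then obtain c where c: "c > 0" "\<And>n. poincare TYPE('x) p c (G n)" by blast
    have "c / 2 \<le> ?g n" for n unfolding spectral_gap_ge_iff[OF G ne] using c by simp
    then have "c / 2 \<le> (INF n. ?g n)" by (intro cINF_greatest) auto
    then show "(INF n. ?g n) > 0" using c by linarith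
  qed
  then show ?thesis by (auto simp: anders_def)
qed (auto simp: anders_def)

lemma card_out_arcs_le:
  assumes "finite_connected_graph G" "max_degree G \<le> D" "v \<in> verts G"
  shows "card (out_arcs G v) \<le> D"
proof -
  have "out_degree G v \<le> max_degree G"
    unfolding max_degree_def by (rule Max_ge) (use assms finite_connected_graphD[OF assms(1)] in auto)
  then show ?thesis using assms by (simp add: out_degree_def)
qed

lemma sum_tail_le:
  fixes F :: "'v \<Rightarrow> real"
  assumes G: "finite_connected_graph G" and D: "max_degree G \<le> D" and F: "\<And>v. v \<in> verts G \<Longrightarrow> 0 \<le> F v"
  shows "(\<Sum>e\<in>arcs G. F (tail G e)) \<le> D * (\<Sum>v\<in>verts G. F v)"
proof -
  have "(\<Sum>e\<in>arcs G. F (tail G e)) = (\<Sum>v\<in>verts G. card (out_arcs G v) * F v)"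
    using sum_out_arcs[OF G, of "\<lambda>v e. F v"] by simp
  also have "\<dots> \<le> (\<Sum>v\<in>verts G. D * F v)"
    using card_out_arcs_le[OF G D] F by (intro sum_mono mult_right_mono) auto
  finally show ?thesis by (simp add: sum_distrib_left)
qed

text \<open>
  The closed half-line is needed because a function may vanish at some vertices; the derivative test only covers
  the open one.
\<close>
lemma convex_on_powr_nonneg:
  assumes "p \<ge> 1"
  shows "convex_on {0::real..} (\<lambda>x. x powr p)"
proof -
  have z: "(s * x) powr p \<le> s * x powr p" if "0 \<le> s" "s \<le> 1" "0 \<le> x" for s x :: real
  proof -
    have "s powr p \<le> s" using that assms powr_mono'[of 1 p s] by (cases "s = 0") auto
    then show ?thesis using that by (simp add: powr_mult mult_right_mono)
  qed
  show ?thesis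
  proof (rule convex_onI)
    fix t x y :: real assume h: "0 < t" "t < 1" "x \<in> {0..}" "y \<in> {0..}"
    consider "x = 0" | "y = 0" | "x > 0" "y > 0" using h by fastforce
    then show "((1 - t) *\<^sub>R x + t *\<^sub>R y) powr p \<le> (1 - t) * x powr p + t * y powr p"
    proof cases
      case 3
      then show ?thesis using convex_onD[OF powr_convex[OF assms], of t x y] h by simp
    qed (use h z[of t y] z[of "1-t" x] in auto)
  qed auto
qed

lemma norm_graph_mean_powr_le:
  fixes f :: "'v \<Rightarrow> 'x::real_normed_vector"
  assumes G: "finite_connected_graph G" and p: "p \<ge> 1"
  shows "card (verts G) * norm (graph_mean G f) powr p \<le> (\<Sum>v\<in>verts G. norm (f v) powr p)"
proof -
  note fin = finite_connected_graphD[OF G]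
  let ?n = "real (card (verts G))"
  have n: "?n > 0" using fin by linarith
  have "norm (graph_mean G f) \<le> (\<Sum>v\<in>verts G. (1 / ?n) *\<^sub>R norm (f v))"
    unfolding graph_mean_def using norm_sum[of f "verts G"]
    by (simp add: mult_left_mono divide_inverse_commute flip: sum_distrib_left)
  then have "norm (graph_mean G f) powr p \<le> (\<Sum>v\<in>verts G. (1 / ?n) *\<^sub>R norm (f v)) powr p"
    using p by (intro powr_mono2) auto
  also have "\<dots> \<le> (\<Sum>v\<in>verts G. (1 / ?n) * norm (f v) powr p)"
    by (rule convex_on_sum[OF _ _ convex_on_powr_nonneg[OF p]]) (use fin n in auto)
  also have "\<dots> = (\<Sum>v\<in>verts G. norm (f v) powr p) / ?n"
    by (simp add: sum_divide_distrib)
  finally show ?thesis using n by (simp add: pos_le_divide_eq mult.commute)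
qed

lemma powr_add_le:
  fixes a b :: real
  assumes "a \<ge> 0" "b \<ge> 0" "p \<ge> 0"
  shows "(a + b) powr p \<le> 2 powr p * (a powr p + b powr p)"
proof -
  have "(a + b) powr p \<le> (2 * max a b) powr p" using assms by (intro powr_mono2) auto
  also have "\<dots> = 2 powr p * (max a b) powr p" using assms by (simp add: powr_mult)
  also have "\<dots> \<le> 2 powr p * (a powr p + b powr p)" by (auto simp: max_def)
  finally show ?thesis .
qed

text \<open>
  Up to a factor, no constant approximates \<open>f\<close> better than the mean does, since \<open>f \<mapsto> m(f)\<close> does not increase
  the normalised \<open>L\<^sub>p\<close> norm and fixes constants.
\<close>
lemma variance_le_deviation:
  fixes f :: "'v \<Rightarrow> 'x::real_normed_vector"
  assumes G: "finite_connected_graph G" and p: "p \<ge> 1"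
  shows "(\<Sum>v\<in>verts G. norm (f v - graph_mean G f) powr p)
    \<le> 2 * 2 powr p * (\<Sum>v\<in>verts G. norm (f v - a) powr p)"
proof -
  let ?g = "\<lambda>v. f v - a"
  have "norm (f v - graph_mean G f) powr p
      \<le> 2 powr p * (norm (f v - a) powr p + norm (graph_mean G ?g) powr p)" for v
  proof -
    have "norm (f v - graph_mean G f) \<le> norm (f v - a) + norm (graph_mean G ?g)"
      using norm_triangle_ineq4[of "f v - a" "graph_mean G ?g"] graph_mean_diff[OF G, of f a] by simp
    then have "norm (f v - graph_mean G f) powr p \<le> (norm (f v - a) + norm (graph_mean G ?g)) powr p"
      using p by (intro powr_mono2) auto
    then show ?thesis using powr_add_le[of "norm (f v - a)" "norm (graph_mean G ?g)" p] p by simp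
  qed
  then have "(\<Sum>v\<in>verts G. norm (f v - graph_mean G f) powr p)
      \<le> (\<Sum>v\<in>verts G. 2 powr p * (norm (f v - a) powr p + norm (graph_mean G ?g) powr p))"
    by (intro sum_mono)
  also have "\<dots> = 2 powr p * ((\<Sum>v\<in>verts G. norm (f v - a) powr p) + card (verts G) * norm (graph_mean G ?g) powr p)"
    by (simp add: sum.distrib flip: sum_distrib_left)
  also have "\<dots> \<le> 2 powr p * (2 * (\<Sum>v\<in>verts G. norm (f v - a) powr p))"
    using norm_graph_mean_powr_le[OF G p, of ?g] by (intro mult_left_mono) auto
  finally show ?thesis by (simp add: mult_ac)
qed

section \<open>Transfer along sphere equivalences\<close>

text \<open>
  With \<open>a = p / q\<close> and \<open>\<phi>\<close> the identity this is the Mazur map that underlies the comparison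
  of \<open>L\<^sub>p\<close> and \<open>L\<^sub>q\<close>. At \<open>0\<close> the value is \<open>0\<close>.
\<close>
definition radial_extension ::
  "real \<Rightarrow> ('x::real_normed_vector \<Rightarrow> 'y::real_normed_vector) \<Rightarrow> 'x \<Rightarrow> 'y" where
  "radial_extension a \<phi> x = norm x powr a *\<^sub>R \<phi> (sgn x)"

lemma sgn_mem_sphere:
  fixes x :: "'x::real_normed_vector"
  shows "x \<noteq> 0 \<Longrightarrow> sgn x \<in> sphere 0 1"
  by (simp add: norm_sgn)

lemma norm_radial_extension:
  assumes "\<And>x. x \<in> sphere 0 1 \<Longrightarrow> \<phi> x \<in> sphere 0 1"
  shows "norm (radial_extension a \<phi> x) = norm x powr a"
  using assms[OF sgn_mem_sphere, of x] by (cases "x = 0") (auto simp: radial_extension_def)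

lemma radial_extension_inverse:
  assumes "\<And>x. x \<in> sphere 0 1 \<Longrightarrow> \<phi> x \<in> sphere 0 1"
    and "\<And>x. x \<in> sphere 0 1 \<Longrightarrow> \<psi> (\<phi> x) = x" and "a * b = 1"
  shows "radial_extension b \<psi> (radial_extension a \<phi> x) = x"
proof (cases "x = 0")
  case False
  let ?y = "radial_extension a \<phi> x"
  have s: "sgn x \<in> sphere 0 1" using False by (rule sgn_mem_sphere)
  have n: "norm (\<phi> (sgn x)) = 1" using assms(1)[OF s] by simp
  have "sgn ?y = \<phi> (sgn x)"
    using n False by (simp add: radial_extension_def sgn_scaleR) (simp add: sgn_div_norm)
  moreover have "norm ?y powr b = norm x"
    using n False assms(3) by (simp add: radial_extension_def powr_powr)
  ultimately have "radial_extension b \<psi> ?y = norm x *\<^sub>R \<psi> (\<phi> (sgn x))"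
    by (simp only: radial_extension_def[of b])
  also have "\<dots> = x" using assms(2)[OF s] False by (simp add: sgn_div_norm)
  finally show ?thesis .
qed (simp add: radial_extension_def)

lemma dist_sgn_le:
  fixes x y :: "'x::real_normed_vector"
  assumes "x \<noteq> 0" "y \<noteq> 0"
  shows "norm (sgn x - sgn y) \<le> 2 * norm (x - y) / norm x"
proof -
  have "sgn x - sgn y = (x - y) /\<^sub>R norm x + (1 / norm x - 1 / norm y) *\<^sub>R y"
    by (simp add: sgn_div_norm algebra_simps divide_inverse)
  then have "norm (sgn x - sgn y) \<le> norm ((x - y) /\<^sub>R norm x) + norm ((1 / norm x - 1 / norm y) *\<^sub>R y)"
    by (simp only: norm_triangle_ineq)
  also have "norm ((1 / norm x - 1 / norm y) *\<^sub>R y) = \<bar>(1 / norm x - 1 / norm y) * norm y\<bar>"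
    by (simp add: abs_mult)
  also have "(1 / norm x - 1 / norm y) * norm y = (norm y - norm x) / norm x"
    using assms by (simp add: field_simps)
  also have "\<bar>(norm y - norm x) / norm x\<bar> \<le> norm (x - y) / norm x"
    using norm_triangle_ineq3[of x y] by (simp add: abs_divide divide_right_mono abs_minus_commute)
  finally show ?thesis by (simp add: divide_inverse mult.commute)
qed

text \<open>
  Dividing by \<open>\<parallel>x\<parallel>\<^sup>a\<close> reduces to \<open>\<parallel>x\<parallel> = 1\<close>; then the directions and the norms of \<open>x\<close> and \<open>y\<close> are close,
  so the claim combines uniform continuity of \<open>\<phi>\<close> with continuity of \<open>t \<mapsto> t\<^sup>a\<close> at \<open>1\<close>.
\<close>
lemma radial_extension_close:
  fixes \<phi> :: "'x::real_normed_vector \<Rightarrow> 'y::real_normed_vector"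
  assumes \<phi>: "\<And>x. x \<in> sphere 0 1 \<Longrightarrow> \<phi> x \<in> sphere 0 1"
    and uc: "uniformly_continuous_on (sphere 0 1) \<phi>" and "\<tau> > 0"
  shows "\<exists>\<delta>>0. \<forall>x y. x \<noteq> 0 \<longrightarrow> norm (x - y) < \<delta> * norm x \<longrightarrow>
     norm (radial_extension a \<phi> x - radial_extension a \<phi> y) \<le> \<tau> * norm x powr a"
proof -
  obtain d1 where d1: "d1 > 0"
    "\<And>x y. x \<in> sphere 0 1 \<Longrightarrow> y \<in> sphere 0 1 \<Longrightarrow> dist y x < d1 \<Longrightarrow> dist (\<phi> y) (\<phi> x) < \<tau> / 2"
    using uc \<open>\<tau> > 0\<close> unfolding uniformly_continuous_on_def by (meson half_gt_zero)
  have "isCont (\<lambda>t::real. t powr a) 1" by (intro continuous_intros) auto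
  then obtain d2 where d2: "d2 > 0" "\<And>t. \<bar>t - 1\<bar> < d2 \<Longrightarrow> \<bar>t powr a - 1\<bar> < \<tau> / 2"
    using \<open>\<tau> > 0\<close> unfolding continuous_at_eps_delta
    by (metis half_gt_zero powr_one_eq_one dist_real_def)
  define \<delta> where "\<delta> = min (min (d1 / 2) d2) 1"
  have "norm (radial_extension a \<phi> x - radial_extension a \<phi> y) \<le> \<tau> * norm x powr a"
    if x: "x \<noteq> 0" and close: "norm (x - y) < \<delta> * norm x" for x y
  proof -
    have nx: "norm x > 0" using x by simp
    have y: "y \<noteq> 0"
    proof
      assume "y = 0"
      then have "norm x < \<delta> * norm x" using close by simp
      also have "\<dots> \<le> 1 * norm x" by (rule mult_right_mono) (auto simp: \<delta>_def)
      finally show False by simp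
    qed
    have r: "norm (x - y) / norm x < \<delta>" using close nx by (simp add: pos_divide_less_eq)
    have "dist (sgn y) (sgn x) < d1"
      using dist_sgn_le[OF x y] r unfolding \<delta>_def by (simp add: dist_norm norm_minus_commute mult.commute)
    then have "norm (\<phi> (sgn x) - \<phi> (sgn y)) < \<tau> / 2"
      using d1(2)[of "sgn x" "sgn y"] sgn_mem_sphere[OF x] sgn_mem_sphere[OF y]
      by (simp add: dist_norm norm_minus_commute)
    moreover have "\<bar>norm y / norm x - 1\<bar> \<le> norm (x - y) / norm x"
    proof -
      have "\<bar>norm y / norm x - 1\<bar> = \<bar>norm x - norm y\<bar> / norm x"
        using nx by (simp add: field_simps abs_divide flip: abs_minus_commute)
      then show ?thesis using norm_triangle_ineq3[of x y] by (simp add: divide_right_mono)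
    qed
    then have "\<bar>(norm y / norm x) powr a - 1\<bar> < \<tau> / 2"
      by (intro d2(2)) (use r in \<open>simp add: \<delta>_def\<close>)
    moreover have "radial_extension a \<phi> x - radial_extension a \<phi> y = norm x powr a *\<^sub>R
        ((\<phi> (sgn x) - \<phi> (sgn y)) + (1 - (norm y / norm x) powr a) *\<^sub>R \<phi> (sgn y))"
      using nx by (simp add: radial_extension_def algebra_simps powr_divide)
    moreover have "norm (\<phi> (sgn y)) = 1"
      using \<phi>[OF sgn_mem_sphere[OF y]] by simp
    ultimately have "norm (radial_extension a \<phi> x - radial_extension a \<phi> y) \<le> norm x powr a * (\<tau> / 2 + \<tau> / 2)"
      by (auto intro!: mult_left_mono norm_triangle_le simp: abs_minus_commute)
    then show ?thesis by (simp add: mult.commute)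
  qed
  moreover have "\<delta> > 0" using d1 d2 by (simp add: \<delta>_def)
  ultimately show ?thesis by blast
qed

text \<open>
  If \<open>x\<close> and \<open>y\<close> are relatively close, the first term alone suffices; if not, both norms are bounded by a multiple of
  \<open>\<parallel>x - y\<parallel>\<close> and the second does. Being pointwise, the estimate sums over any
  finite index set with the same constants, which is what makes the transfer independent of the graph.
\<close>
lemma radial_extension_powr_estimate:
  fixes \<phi> :: "'x::real_normed_vector \<Rightarrow> 'y::real_normed_vector"
  assumes \<phi>: "\<And>x. x \<in> sphere 0 1 \<Longrightarrow> \<phi> x \<in> sphere 0 1"
    and uc: "uniformly_continuous_on (sphere 0 1) \<phi>"
    and pq: "p > 0" "q > 0" and "\<eta> > 0"
  shows "\<exists>C>0. \<forall>x y. norm (radial_extension (p / q) \<phi> x - radial_extension (p / q) \<phi> y) powr q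
     \<le> \<eta> * norm x powr p + C * norm (x - y) powr p"
proof -
  let ?\<Phi> = "radial_extension (p / q) \<phi>"
  obtain \<delta> where \<delta>: "\<delta> > 0" "\<And>x y. x \<noteq> 0 \<Longrightarrow> norm (x - y) < \<delta> * norm x \<Longrightarrow>
     norm (?\<Phi> x - ?\<Phi> y) \<le> \<eta> powr (1 / q) * norm x powr (p / q)"
    using radial_extension_close[OF \<phi> uc, of "\<eta> powr (1 / q)" "p / q"] \<open>\<eta> > 0\<close> by auto
  have norm\<Phi>: "norm (?\<Phi> z) powr q = norm z powr p" for z
    using pq norm_radial_extension[of \<phi> "p / q" z, OF \<phi>] by (simp add: powr_powr)
  \<comment> \<open>both norms are at most \<open>K \<parallel>x - y\<parallel>\<close> when \<open>\<delta> \<parallel>x\<parallel> \<le> \<parallel>x - y\<parallel>\<close>\<close>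
  define K where "K = 1 / \<delta> + 1"
  have K: "K > 0" using \<delta>(1) by (simp add: K_def add_pos_pos)
  define C where "C = 2 powr q * (2 * K powr p)"
  have "norm (?\<Phi> x - ?\<Phi> y) powr q \<le> \<eta> * norm x powr p + C * norm (x - y) powr p" for x y
  proof (cases "x \<noteq> 0 \<and> norm (x - y) < \<delta> * norm x")
    case True
    then have "norm (?\<Phi> x - ?\<Phi> y) powr q \<le> (\<eta> powr (1 / q) * norm x powr (p / q)) powr q"
      using \<delta>(2)[of x y] pq by (intro powr_mono2) auto
    also have "\<dots> = \<eta> * norm x powr p"
      using pq \<open>\<eta> > 0\<close> by (simp add: powr_mult powr_powr)
    also have "\<dots> \<le> \<eta> * norm x powr p + C * norm (x - y) powr p" by (simp add: C_def)
    finally show ?thesis .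
  next
    case False
    then have "norm x * \<delta> \<le> norm (x - y)" by (auto simp: mult.commute)
    then have x: "norm x \<le> norm (x - y) / \<delta>" using \<delta>(1) by (simp add: pos_le_divide_eq)
    have y: "norm y \<le> norm x + norm (x - y)" using norm_triangle_sub[of y x] by (simp add: norm_minus_commute)
    have "norm x \<le> K * norm (x - y)" "norm y \<le> K * norm (x - y)"
      using x y unfolding K_def by (auto simp: algebra_simps intro: order_trans)
    then have xy: "norm x powr p \<le> (K * norm (x - y)) powr p" "norm y powr p \<le> (K * norm (x - y)) powr p"
      using pq by (auto intro!: powr_mono2)
    have "norm (?\<Phi> x - ?\<Phi> y) powr q \<le> (norm (?\<Phi> x) + norm (?\<Phi> y)) powr q"
      using pq by (intro powr_mono2 norm_triangle_ineq4) auto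
    also have "\<dots> \<le> 2 powr q * (norm x powr p + norm y powr p)"
      using powr_add_le[of "norm (?\<Phi> x)" "norm (?\<Phi> y)" q] pq by (simp add: norm\<Phi>)
    also have "\<dots> \<le> 2 powr q * (2 * (K * norm (x - y)) powr p)"
      using xy by (intro mult_left_mono) auto
    also have "\<dots> = C * norm (x - y) powr p" using K by (simp add: C_def powr_mult)
    also have "\<dots> \<le> \<eta> * norm x powr p + C * norm (x - y) powr p" using \<open>\<eta> > 0\<close> by simp
    finally show ?thesis .
  qed
  moreover have "C > 0" using K by (simp add: C_def)
  ultimately show ?thesis by blast
qed

text \<open>
  With \<open>S = \<Sum>\<^sub>v \<parallel>f v\<parallel>\<^sup>p\<close> for \<open>f\<close> of mean zero and \<open>E\<close> the \<open>p\<close>-energy of \<open>f\<close>, applying \<open>\<Phi>\<close>, then the inequality in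
  \<open>Y\<close>, then \<open>\<Psi>\<close> bounds \<open>S\<close> by a small multiple of \<open>S\<close> plus a constant times \<open>E\<close>. The conditions on \<open>\<theta>\<close> and
  \<open>\<eta>\<close> make each of the two error terms at most \<open>S / 4\<close>, so they can be absorbed.
\<close>
lemma poincare_transfer:
  fixes \<Phi> :: "'x::real_normed_vector \<Rightarrow> 'y::real_normed_vector" and \<Psi> :: "'y \<Rightarrow> 'x"
  assumes G: "finite_connected_graph (G :: ('v, 'e) pre_digraph)" and D: "max_degree G \<le> D"
    and p: "p \<ge> 1" and c: "c > 0" and P: "poincare TYPE('y) q c G"
    and \<Psi>\<Phi>: "\<And>x. \<Psi> (\<Phi> x) = x" and norm\<Phi>: "\<And>x. norm (\<Phi> x) powr q = norm x powr p"
    and \<Psi>: "\<And>x y. norm (\<Psi> x - \<Psi> y) powr p \<le> \<theta> * norm x powr q + C' * norm (x - y) powr q"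
    and \<Phi>: "\<And>x y. norm (\<Phi> x - \<Phi> y) powr q \<le> \<eta> * norm x powr p + C * norm (x - y) powr p"
    and pos: "C > 0" "C' > 0" "\<eta> > 0"
    and \<theta>: "2 * 2 powr p * \<theta> \<le> 1 / 4" and \<eta>: "2 * 2 powr p * C' * \<eta> * D \<le> c / 4"
  shows "poincare TYPE('x) p (c / (4 * 2 powr p * C' * C)) G"
  unfolding poincare_def
proof
  fix f0 :: "'v \<Rightarrow> 'x"
  note fin = finite_connected_graphD[OF G]
  define f where "f v = f0 v - graph_mean G f0" for v
  define h where "h v = \<Phi> (f v)" for v
  define b where "b = graph_mean G h"
  define S where "S = (\<Sum>v\<in>verts G. norm (f v) powr p)"
  define E where "E = (\<Sum>e\<in>arcs G. norm (f (head G e) - f (tail G e)) powr p)"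
  define B where "B = 2 * 2 powr p"
  have B: "B > 0" by (simp add: B_def)
  have S0: "S \<ge> 0" unfolding S_def by (intro sum_nonneg) auto
  have mean: "graph_mean G f = 0" using graph_mean_diff[OF G, of f0 "graph_mean G f0"] by (simp add: f_def[abs_def])
  have "c * (\<Sum>v\<in>verts G. norm (h v - b) powr q)
      \<le> (\<Sum>e\<in>arcs G. norm (h (tail G e) - h (head G e)) powr q)"
    using P unfolding poincare_def b_def by (simp add: norm_minus_commute)
  also have "\<dots> \<le> (\<Sum>e\<in>arcs G. \<eta> * norm (f (tail G e)) powr p
      + C * norm (f (tail G e) - f (head G e)) powr p)"
    unfolding h_def by (intro sum_mono \<Phi>)
  also have "\<dots> = \<eta> * (\<Sum>e\<in>arcs G. norm (f (tail G e)) powr p) + C * E"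
    by (simp add: sum.distrib E_def sum_distrib_left norm_minus_commute)
  also have "\<dots> \<le> \<eta> * (D * S) + C * E"
    using sum_tail_le[OF G D, of "\<lambda>v. norm (f v) powr p"] pos unfolding S_def by simp
  finally have H: "c * (\<Sum>v\<in>verts G. norm (h v - b) powr q) \<le> \<eta> * (D * S) + C * E" .
  have "S \<le> B * (\<Sum>v\<in>verts G. norm (f v - \<Psi> b) powr p)"
    using variance_le_deviation[OF G p, of f "\<Psi> b"] mean by (simp add: S_def B_def)
  also have "(\<Sum>v\<in>verts G. norm (f v - \<Psi> b) powr p)
      \<le> (\<Sum>v\<in>verts G. \<theta> * norm (f v) powr p + C' * norm (h v - b) powr q)"
    using \<Psi>[of "h _" b] by (intro sum_mono) (simp add: h_def \<Psi>\<Phi> norm\<Phi>)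
  also have "\<dots> = \<theta> * S + C' * (\<Sum>v\<in>verts G. norm (h v - b) powr q)"
    by (simp add: sum.distrib S_def sum_distrib_left)
  finally have "S \<le> B * (\<theta> * S + C' * (\<Sum>v\<in>verts G. norm (h v - b) powr q))"
    using B by simp
  then have "c * S \<le> c * (B * (\<theta> * S + C' * (\<Sum>v\<in>verts G. norm (h v - b) powr q)))"
    using c by (intro mult_left_mono) auto
  also have "\<dots> = c * (B * \<theta>) * S + B * C' * (c * (\<Sum>v\<in>verts G. norm (h v - b) powr q))"
    by (simp add: algebra_simps)
  also have "\<dots> \<le> c * (1 / 4) * S + B * C' * (\<eta> * (D * S) + C * E)"
    using \<theta> H c B pos S0 by (intro add_mono mult_left_mono mult_right_mono) (auto simp: B_def)
  also have "\<dots> = c / 4 * S + (B * C' * \<eta> * D) * S + B * C' * C * E"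
    by (simp add: algebra_simps)
  also have "\<dots> \<le> c / 4 * S + c / 4 * S + B * C' * C * E"
    using \<eta> S0 by (intro add_mono mult_right_mono order_refl) (auto simp: B_def)
  finally have "c * S \<le> 2 * (B * C' * C) * E" by (simp add: mult_ac)
  then have "c / (2 * (B * C' * C)) * S \<le> E"
    using B pos by (simp add: pos_divide_le_eq mult.commute)
  moreover have "S = (\<Sum>v\<in>verts G. norm (f0 v - graph_mean G f0) powr p)"
    by (simp add: S_def f_def)
  moreover have "E = (\<Sum>e\<in>arcs G. norm (f0 (head G e) - f0 (tail G e)) powr p)"
    by (simp add: E_def f_def)
  ultimately show "c / (4 * 2 powr p * C' * C) * (\<Sum>v\<in>verts G. norm (f0 v - graph_mean G f0) powr p)
      \<le> (\<Sum>e\<in>arcs G. norm (f0 (head G e) - f0 (tail G e)) powr p)"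
    by (simp add: B_def mult.assoc)
qed

text \<open>
  The order of choices matters: \<open>\<theta>\<close> for the inverse map fixes \<open>C'\<close>, then \<open>\<eta>\<close> is chosen depending on \<open>C'\<close>, and
  this fixes \<open>C\<close>.
\<close>
lemma sphere_equivalent_poincare:
  assumes eq: "sphere_equivalent TYPE('x::real_normed_vector) TYPE('y::real_normed_vector)"
    and pq: "p \<ge> 1" "q \<ge> 1" and c: "c > 0"
  shows "\<exists>c'>0. \<forall>G :: ('v, 'e) pre_digraph. finite_connected_graph G \<longrightarrow> max_degree G \<le> D \<longrightarrow>
    poincare TYPE('y) q c G \<longrightarrow> poincare TYPE('x) p c' G"
proof -
  obtain \<phi> :: "'x \<Rightarrow> 'y" where bij: "bij_betw \<phi> (sphere 0 1) (sphere 0 1)"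
    and uc: "uniformly_continuous_on (sphere 0 1) \<phi>"
    and uc': "uniformly_continuous_on (sphere 0 1) (inv_into (sphere 0 1) \<phi>)"
    using eq unfolding sphere_equivalent_def by blast
  define \<psi> where "\<psi> = inv_into (sphere 0 1) \<phi>"
  have \<phi>: "\<phi> x \<in> sphere 0 1" if "x \<in> sphere 0 1" for x using bij that by (rule bij_betw_apply)
  have \<psi>: "\<psi> x \<in> sphere 0 1" if "x \<in> sphere 0 1" for x
    using bij_betw_inv_into[OF bij] that unfolding \<psi>_def by (rule bij_betw_apply)
  have \<psi>\<phi>: "\<psi> (\<phi> x) = x" if "x \<in> sphere 0 1" for x
    using bij that unfolding \<psi>_def by (simp add: bij_betw_inv_into_left)
  let ?\<Phi> = "radial_extension (p / q) \<phi>" and ?\<Psi> = "radial_extension (q / p) \<psi>"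
  define B :: real where "B = 2 * 2 powr p"
  have B: "B > 0" by (simp add: B_def)
  obtain C' where C': "C' > 0" "\<And>x y. norm (?\<Psi> x - ?\<Psi> y) powr p
      \<le> 1 / (4 * B) * norm x powr q + C' * norm (x - y) powr q"
    using radial_extension_powr_estimate[OF \<psi> uc'[folded \<psi>_def], of q p "1 / (4 * B)"] pq B by auto
  define \<eta> where "\<eta> = c / (4 * (B * C' * (real D + 1)))"
  have \<eta>: "\<eta> > 0" using c B C' by (auto simp: \<eta>_def intro!: divide_pos_pos mult_pos_pos)
  obtain C where C: "C > 0" "\<And>x y. norm (?\<Phi> x - ?\<Phi> y) powr q
      \<le> \<eta> * norm x powr p + C * norm (x - y) powr p"
    using radial_extension_powr_estimate[OF \<phi> uc, of p q \<eta>] pq \<eta> by auto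
  have \<eta>_le: "B * C' * \<eta> * D \<le> c / 4"
  proof -
    have "B * C' * \<eta> * D \<le> B * C' * \<eta> * (real D + 1)"
      using B C' \<eta> by (intro mult_left_mono) auto
    also have "\<dots> = c / 4" using B C'(1) by (simp add: \<eta>_def divide_simps)
    finally show ?thesis .
  qed
  show ?thesis
  proof (intro exI[of _ "c / (4 * 2 powr p * C' * C)"] conjI allI impI)
    show "0 < c / (4 * 2 powr p * C' * C)" using c C C' by simp
    fix G :: "('v, 'e) pre_digraph"
    assume G: "finite_connected_graph G" "max_degree G \<le> D" "poincare TYPE('y) q c G"
    show "poincare TYPE('x) p (c / (4 * 2 powr p * C' * C)) G"
    proof (rule poincare_transfer[OF G(1,2) pq(1) c G(3)])
      show "?\<Psi> (?\<Phi> x) = x" for x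
        by (rule radial_extension_inverse[OF \<phi> \<psi>\<phi>]) (use pq in auto)
      show "norm (?\<Phi> x) powr q = norm x powr p" for x
        using pq norm_radial_extension[of \<phi> "p / q" x, OF \<phi>] by (simp add: powr_powr)
      show "2 * 2 powr p * (1 / (4 * B)) \<le> 1 / 4" by (simp add: B_def)
      show "2 * 2 powr p * C' * \<eta> * D \<le> c / 4" using \<eta>_le by (simp add: B_def)
    qed (use C C' \<eta> in auto)
  qed
qed

section \<open>Kernels on finite sets and uniform curvature\<close>

definition kernel_apply :: "'v set \<Rightarrow> ('v \<Rightarrow> 'v \<Rightarrow> real) \<Rightarrow> ('v \<Rightarrow> 'x::real_vector) \<Rightarrow> 'v \<Rightarrow> 'x" where
  "kernel_apply V K f v = (\<Sum>w\<in>V. K v w *\<^sub>R f w)"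

text \<open>
  The operator norm bound \<open>\<parallel>K \<otimes> I\<^sub>X\<parallel> \<le> \<Lambda>\<close>, for \<open>\<Lambda> \<ge> 0\<close>, of a kernel on a finite set. The norms
  are unnormalised, since the factor \<open>1 / n\<close> cancels, and no supremum is involved.
\<close>
definition L2_bounded :: "'x::real_normed_vector itself \<Rightarrow> 'v set \<Rightarrow> real \<Rightarrow> ('v \<Rightarrow> 'v \<Rightarrow> real) \<Rightarrow> bool" where
  "L2_bounded _ V \<Lambda> K \<longleftrightarrow> (\<forall>f :: 'v \<Rightarrow> 'x.
     (\<Sum>v\<in>V. (norm (kernel_apply V K f v))\<^sup>2) \<le> \<Lambda>\<^sup>2 * (\<Sum>v\<in>V. (norm (f v))\<^sup>2))"

lemma kernel_apply_hilbert_schmidt: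
  fixes f :: "'v \<Rightarrow> 'x::real_normed_vector"
  shows "(\<Sum>v\<in>V. (norm (kernel_apply V K f v))\<^sup>2)
    \<le> (\<Sum>v\<in>V. \<Sum>w\<in>V. (K v w)\<^sup>2) * (\<Sum>v\<in>V. (norm (f v))\<^sup>2)"
proof -
  have "(norm (kernel_apply V K f v))\<^sup>2 \<le> (\<Sum>w\<in>V. (K v w)\<^sup>2) * (\<Sum>w\<in>V. (norm (f w))\<^sup>2)" for v
  proof -
    have "norm (kernel_apply V K f v) \<le> (\<Sum>w\<in>V. \<bar>K v w\<bar> * norm (f w))"
      unfolding kernel_apply_def by (rule order_trans[OF norm_sum]) simp
    then have "(norm (kernel_apply V K f v))\<^sup>2 \<le> (\<Sum>w\<in>V. \<bar>K v w\<bar> * norm (f w))\<^sup>2"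
      by (intro power_mono) auto
    also have "\<dots> \<le> (\<Sum>w\<in>V. \<bar>K v w\<bar>\<^sup>2) * (\<Sum>w\<in>V. (norm (f w))\<^sup>2)"
      by (rule Cauchy_Schwarz_ineq_sum)
    finally show ?thesis by simp
  qed
  then show ?thesis unfolding sum_distrib_right by (rule sum_mono)
qed

lemma L2_bounded_of_abs:
  assumes "L2_bounded TYPE(real) V \<Lambda> (\<lambda>v w. \<bar>K v w\<bar>)"
  shows "L2_bounded TYPE('x::real_normed_vector) V \<Lambda> K"
  unfolding L2_bounded_def
proof
  fix f :: "_ \<Rightarrow> 'x"
  have "norm (kernel_apply V K f v) \<le> norm (kernel_apply V (\<lambda>v w. \<bar>K v w\<bar>) (\<lambda>w. norm (f w)) v)" for v
    unfolding kernel_apply_def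
    by (rule order_trans[OF norm_sum]) (simp add: sum_nonneg)
  then have "(\<Sum>v\<in>V. (norm (kernel_apply V K f v))\<^sup>2)
      \<le> (\<Sum>v\<in>V. (norm (kernel_apply V (\<lambda>v w. \<bar>K v w\<bar>) (\<lambda>w. norm (f w)) v))\<^sup>2)"
    by (intro sum_mono power_mono) auto
  also have "\<dots> \<le> \<Lambda>\<^sup>2 * (\<Sum>v\<in>V. (norm (norm (f v)))\<^sup>2)"
    using assms unfolding L2_bounded_def by (rule spec)
  finally show "(\<Sum>v\<in>V. (norm (kernel_apply V K f v))\<^sup>2) \<le> \<Lambda>\<^sup>2 * (\<Sum>v\<in>V. (norm (f v))\<^sup>2)"
    by simp
qed

text \<open>
  A real supremum says something about its members only when they are bounded above; here the Hilbert-Schmidt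
  norm of \<open>T\<close> is an upper bound. The case \<open>L2_norm n x = 0\<close>, where the quotient has the default value \<open>0\<close>,
  is harmless for the same reason: the numerator vanishes too.
\<close>
lemma L2_onorm_le_iff:
  assumes n: "n \<ge> 1" and \<Lambda>: "\<Lambda> \<ge> 0"
  shows "L2_onorm TYPE('x::real_normed_vector) n T \<le> \<Lambda> \<longleftrightarrow> L2_bounded TYPE('x) {..<n} \<Lambda> T"
proof -
  define A where "A x = (\<Sum>i<n. (norm (kernel_apply {..<n} T x i))\<^sup>2)" for x :: "nat \<Rightarrow> 'x"
  define B where "B x = (\<Sum>i<n. (norm (x i))\<^sup>2)" for x :: "nat \<Rightarrow> 'x"
  define q where "q x = L2_norm n (\<lambda>i. \<Sum>j<n. T i j *\<^sub>R x j) / L2_norm n x" for x :: "nat \<Rightarrow> 'x"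
  have A0: "A x \<ge> 0" and B0: "B x \<ge> 0" for x by (auto simp: A_def B_def intro!: sum_nonneg)
  have q: "q x = sqrt (A x / B x)" for x
    using n by (simp add: q_def L2_norm_def A_def B_def kernel_apply_def real_sqrt_divide)
  have iff: "q x \<le> M \<longleftrightarrow> A x \<le> M\<^sup>2 * B x" if M: "M \<ge> 0" for x M
  proof (cases "B x = 0")
    case True
    have "A x \<le> 0" using kernel_apply_hilbert_schmidt[of "{..<n}" T x] True unfolding A_def B_def by simp
    then show ?thesis using True M by (simp add: q)
  next
    case False
    then have "B x > 0" using B0[of x] by simp
    have "q x \<le> M \<longleftrightarrow> sqrt (A x / B x) \<le> sqrt (M\<^sup>2)" using M by (simp add: q)
    also have "\<dots> \<longleftrightarrow> A x / B x \<le> M\<^sup>2" by (rule real_sqrt_le_iff)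
    finally show ?thesis using \<open>B x > 0\<close> by (simp add: pos_divide_le_eq)
  qed
  define F where "F = (\<Sum>i<n. \<Sum>j<n. (T i j)\<^sup>2)"
  have F0: "F \<ge> 0" by (auto simp: F_def intro!: sum_nonneg)
  have "q x \<le> sqrt F" for x
    using kernel_apply_hilbert_schmidt[of "{..<n}" T x] F0 by (subst iff) (auto simp: A_def B_def F_def)
  then have bdd: "bdd_above (range q)" by (rule bdd_aboveI2)
  have "L2_onorm TYPE('x) n T \<le> \<Lambda> \<longleftrightarrow> (\<forall>x. q x \<le> \<Lambda>)"
    unfolding L2_onorm_def q_def[symmetric] using cSUP_le_iff[OF _ bdd] by simp
  then show ?thesis using iff[OF \<Lambda>] by (simp add: L2_bounded_def A_def B_def)
qed

text \<open>
  The infimum that defines the curvature modulus is over a nonempty set, because it contains \<open>1\<close>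
  (\<open>L2_bounded_of_abs\<close>), so a small modulus provides an admissible small bound.
\<close>
lemma uniformly_curved_eventually:
  assumes "uniformly_curved TYPE('y::real_normed_vector)" and "\<Lambda> > 0"
  shows "\<exists>\<epsilon>>0. \<forall>n::nat\<ge>1. \<forall>T. L2_bounded TYPE(real) {..<n} \<epsilon> T \<longrightarrow>
     L2_bounded TYPE(real) {..<n} 1 (\<lambda>i j. \<bar>T i j\<bar>) \<longrightarrow> L2_bounded TYPE('y) {..<n} \<Lambda> T"
proof -
  have "\<forall>\<^sub>F \<epsilon> in at_right 0. curvature_modulus TYPE('y) \<epsilon> < \<Lambda>"
    using assms unfolding uniformly_curved_def by (intro order_tendstoD)
  then obtain b where b: "b > 0" "\<And>\<epsilon>. 0 < \<epsilon> \<Longrightarrow> \<epsilon> < b \<Longrightarrow> curvature_modulus TYPE('y) \<epsilon> < \<Lambda>"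
    unfolding eventually_at_right_field by auto
  define \<epsilon> where "\<epsilon> = b / 2"
  have \<epsilon>: "\<epsilon> > 0" "curvature_modulus TYPE('y) \<epsilon> < \<Lambda>" using b by (auto simp: \<epsilon>_def)
  let ?S = "{\<Lambda>. \<Lambda> > 0 \<and>
       (\<forall>n\<ge>1. \<forall>T. L2_onorm TYPE(real) n T \<le> \<epsilon> \<and>
          L2_onorm TYPE(real) n (\<lambda>i j. \<bar>T i j\<bar>) \<le> 1 \<longrightarrow> L2_onorm TYPE('y) n T \<le> \<Lambda>)}"
  have "1 \<in> ?S" using L2_bounded_of_abs[where 'x='y, of "{..<_}" 1] by (auto simp: L2_onorm_le_iff)
  then have "?S \<noteq> {}" by blast
  moreover have "Inf ?S < \<Lambda>" using \<epsilon>(2) by (simp add: curvature_modulus_def)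
  ultimately obtain M where M: "M \<in> ?S" "M < \<Lambda>" using cInf_lessD[of ?S \<Lambda>] by blast
  show ?thesis
  proof (intro exI[of _ \<epsilon>] conjI allI impI)
    fix n :: nat and T
    assume n: "1 \<le> n" and T: "L2_bounded TYPE(real) {..<n} \<epsilon> T"
      "L2_bounded TYPE(real) {..<n} 1 (\<lambda>i j. \<bar>T i j\<bar>)"
    then have "L2_onorm TYPE(real) n T \<le> \<epsilon>" "L2_onorm TYPE(real) n (\<lambda>i j. \<bar>T i j\<bar>) \<le> 1"
      using \<epsilon> by (auto simp: L2_onorm_le_iff)
    then have "L2_onorm TYPE('y) n T \<le> M" using M(1) n by blast
    then have "L2_onorm TYPE('y) n T \<le> \<Lambda>" using M(2) by linarith
    then show "L2_bounded TYPE('y) {..<n} \<Lambda> T" using n assms(2) by (simp add: L2_onorm_le_iff)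
  qed (rule \<epsilon>)
qed

lemma L2_bounded_reindex:
  fixes K :: "'v \<Rightarrow> 'v \<Rightarrow> real"
  assumes b: "bij_betw b I V"
  shows "L2_bounded TYPE('x::real_normed_vector) I \<Lambda> (\<lambda>i j. K (b i) (b j)) \<longleftrightarrow> L2_bounded TYPE('x) V \<Lambda> K"
proof -
  have app: "kernel_apply I (\<lambda>i j. K (b i) (b j)) (f \<circ> b) i = kernel_apply V K f (b i)" for f :: "'v \<Rightarrow> 'x" and i
    unfolding kernel_apply_def using sum.reindex_bij_betw[OF b, of "\<lambda>w. K (b i) w *\<^sub>R f w"] by simp
  have eq: "(\<Sum>i\<in>I. (norm (kernel_apply I (\<lambda>i j. K (b i) (b j)) (f \<circ> b) i))\<^sup>2)
        = (\<Sum>v\<in>V. (norm (kernel_apply V K f v))\<^sup>2)"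
      "(\<Sum>i\<in>I. (norm ((f \<circ> b) i))\<^sup>2) = (\<Sum>v\<in>V. (norm (f v))\<^sup>2)" for f :: "'v \<Rightarrow> 'x"
    unfolding app using sum.reindex_bij_betw[OF b, of "\<lambda>v. (norm (kernel_apply V K f v))\<^sup>2"]
      sum.reindex_bij_betw[OF b, of "\<lambda>v. (norm (f v))\<^sup>2"] by auto
  show ?thesis
  proof
    assume L: "L2_bounded TYPE('x) I \<Lambda> (\<lambda>i j. K (b i) (b j))"
    show "L2_bounded TYPE('x) V \<Lambda> K"
      unfolding L2_bounded_def eq[symmetric] using L unfolding L2_bounded_def by blast
  next
    assume R: "L2_bounded TYPE('x) V \<Lambda> K"
    show "L2_bounded TYPE('x) I \<Lambda> (\<lambda>i j. K (b i) (b j))"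
      unfolding L2_bounded_def
    proof
      fix x :: "_ \<Rightarrow> 'x"
      define f where "f = x \<circ> inv_into I b"
      have fx: "(f \<circ> b) i = x i" if "i \<in> I" for i
        using that b by (simp add: f_def bij_betw_inv_into_left)
      have "kernel_apply I (\<lambda>i j. K (b i) (b j)) (f \<circ> b) = kernel_apply I (\<lambda>i j. K (b i) (b j)) x"
        unfolding kernel_apply_def by (intro ext sum.cong) (use fx in auto)
      moreover have "(\<Sum>i\<in>I. (norm ((f \<circ> b) i))\<^sup>2) = (\<Sum>i\<in>I. (norm (x i))\<^sup>2)"
        using fx by (intro sum.cong) auto
      ultimately show "(\<Sum>i\<in>I. (norm (kernel_apply I (\<lambda>i j. K (b i) (b j)) x i))\<^sup>2)
          \<le> \<Lambda>\<^sup>2 * (\<Sum>i\<in>I. (norm (x i))\<^sup>2)"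
        using R eq[of f] unfolding L2_bounded_def by metis
    qed
  qed
qed

lemma uniformly_curved_L2_bounded:
  assumes "uniformly_curved TYPE('y::real_normed_vector)" and "\<Lambda> > 0"
  shows "\<exists>\<epsilon>>0. \<forall>(V :: 'v set) K. finite V \<longrightarrow> V \<noteq> {} \<longrightarrow> L2_bounded TYPE(real) V \<epsilon> K \<longrightarrow>
     L2_bounded TYPE(real) V 1 (\<lambda>v w. \<bar>K v w\<bar>) \<longrightarrow> L2_bounded TYPE('y) V \<Lambda> K"
proof -
  obtain \<epsilon> where \<epsilon>: "\<epsilon> > 0" "\<And>(n :: nat) T. n \<ge> 1 \<Longrightarrow> L2_bounded TYPE(real) {..<n} \<epsilon> T \<Longrightarrow>
     L2_bounded TYPE(real) {..<n} 1 (\<lambda>i j. \<bar>T i j\<bar>) \<Longrightarrow> L2_bounded TYPE('y) {..<n} \<Lambda> T"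
    using uniformly_curved_eventually[OF assms] by blast
  show ?thesis
  proof (intro exI[of _ \<epsilon>] conjI allI impI)
    fix V :: "'v set" and K
    assume V: "finite V" "V \<noteq> {}" and K: "L2_bounded TYPE(real) V \<epsilon> K"
      "L2_bounded TYPE(real) V 1 (\<lambda>v w. \<bar>K v w\<bar>)"
    obtain b where b: "bij_betw b {..<card V} V"
      using ex_bij_betw_nat_finite[OF V(1)] by (auto simp: atLeast0LessThan)
    have n: "card V \<ge> 1" using V by (simp add: Suc_le_eq card_gt_0_iff)
    show "L2_bounded TYPE('y) V \<Lambda> K"
      unfolding L2_bounded_reindex[OF b, where K=K, symmetric]
    proof (rule \<epsilon>(2)[OF n])
      show "L2_bounded TYPE(real) {..<card V} \<epsilon> (\<lambda>i j. K (b i) (b j))"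
        using K(1) unfolding L2_bounded_reindex[OF b, where K=K] .
      show "L2_bounded TYPE(real) {..<card V} 1 (\<lambda>i j. \<bar>K (b i) (b j)\<bar>)"
        using K(2) unfolding L2_bounded_reindex[OF b, where K="\<lambda>v w. \<bar>K v w\<bar>"] .
    qed
  qed (rule \<epsilon>)
qed

text \<open>
  The Cauchy-Schwarz inequality for the splitting \<open>|K| = \<surd>|K| \<cdot> \<surd>|K|\<close> uses the row sums, and the
  remaining summation uses the column sums.
\<close>
lemma L2_bounded_Schur_test:
  assumes V: "finite V" and row: "\<And>v. v \<in> V \<Longrightarrow> (\<Sum>w\<in>V. \<bar>K v w\<bar>) \<le> 1"
    and col: "\<And>w. w \<in> V \<Longrightarrow> (\<Sum>v\<in>V. \<bar>K v w\<bar>) \<le> 1"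
  shows "L2_bounded TYPE('x::real_normed_vector) V 1 K"
proof (rule L2_bounded_of_abs, unfold L2_bounded_def, rule)
  fix f :: "_ \<Rightarrow> real"
  have "(norm (kernel_apply V (\<lambda>v w. \<bar>K v w\<bar>) f v))\<^sup>2 \<le> (\<Sum>w\<in>V. \<bar>K v w\<bar> * (f w)\<^sup>2)" if v: "v \<in> V" for v
  proof -
    have "(norm (kernel_apply V (\<lambda>v w. \<bar>K v w\<bar>) f v))\<^sup>2
        = (\<Sum>w\<in>V. sqrt \<bar>K v w\<bar> * (sqrt \<bar>K v w\<bar> * f w))\<^sup>2"
      by (simp add: kernel_apply_def flip: mult.assoc)
    also have "\<dots> \<le> (\<Sum>w\<in>V. (sqrt \<bar>K v w\<bar>)\<^sup>2) * (\<Sum>w\<in>V. (sqrt \<bar>K v w\<bar> * f w)\<^sup>2)"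
      by (rule Cauchy_Schwarz_ineq_sum)
    also have "\<dots> \<le> 1 * (\<Sum>w\<in>V. (sqrt \<bar>K v w\<bar> * f w)\<^sup>2)"
      using row[OF v] by (intro mult_right_mono sum_nonneg) auto
    finally show ?thesis by (simp add: power_mult_distrib)
  qed
  then have "(\<Sum>v\<in>V. (norm (kernel_apply V (\<lambda>v w. \<bar>K v w\<bar>) f v))\<^sup>2) \<le> (\<Sum>v\<in>V. \<Sum>w\<in>V. \<bar>K v w\<bar> * (f w)\<^sup>2)"
    by (rule sum_mono)
  also have "\<dots> = (\<Sum>w\<in>V. (\<Sum>v\<in>V. \<bar>K v w\<bar>) * (f w)\<^sup>2)"
    by (subst sum.swap) (simp add: sum_distrib_right)
  also have "\<dots> \<le> (\<Sum>w\<in>V. 1 * (f w)\<^sup>2)"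
    using col by (intro sum_mono mult_right_mono) auto
  finally show "(\<Sum>v\<in>V. (norm (kernel_apply V (\<lambda>v w. \<bar>K v w\<bar>) f v))\<^sup>2) \<le> 1\<^sup>2 * (\<Sum>v\<in>V. (norm (f v))\<^sup>2)"
    by simp
qed

definition doubly_stochastic :: "'v set \<Rightarrow> ('v \<Rightarrow> 'v \<Rightarrow> real) \<Rightarrow> bool" where
  "doubly_stochastic V K \<longleftrightarrow> (\<forall>v\<in>V. \<forall>w\<in>V. K v w \<ge> 0) \<and>
     (\<forall>v\<in>V. (\<Sum>w\<in>V. K v w) = 1) \<and> (\<forall>w\<in>V. (\<Sum>v\<in>V. K v w) = 1)"

primrec kernel_power :: "'v set \<Rightarrow> ('v \<Rightarrow> 'v \<Rightarrow> real) \<Rightarrow> nat \<Rightarrow> 'v \<Rightarrow> 'v \<Rightarrow> real" where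
  "kernel_power V K 0 v w = of_bool (v = w)"
| "kernel_power V K (Suc k) v w = (\<Sum>u\<in>V. K v u * kernel_power V K k u w)"

lemma kernel_apply_power_0:
  assumes "finite V" "v \<in> V"
  shows "kernel_apply V (kernel_power V K 0) f v = f v"
proof -
  have "kernel_apply V (kernel_power V K 0) f v = (\<Sum>w\<in>V. if v = w then f w else 0)"
    unfolding kernel_apply_def by (intro sum.cong) auto
  then show ?thesis using assms by simp
qed

lemma kernel_apply_power_Suc:
  "kernel_apply V (kernel_power V K (Suc k)) f v = kernel_apply V K (kernel_apply V (kernel_power V K k) f) v"
proof -
  have "kernel_apply V (kernel_power V K (Suc k)) f v
      = (\<Sum>w\<in>V. \<Sum>u\<in>V. (K v u * kernel_power V K k u w) *\<^sub>R f w)"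
    by (simp add: kernel_apply_def scaleR_sum_left)
  also have "\<dots> = (\<Sum>u\<in>V. \<Sum>w\<in>V. (K v u * kernel_power V K k u w) *\<^sub>R f w)"
    by (rule sum.swap)
  also have "\<dots> = kernel_apply V K (kernel_apply V (kernel_power V K k) f) v"
    by (simp add: kernel_apply_def scaleR_sum_right)
  finally show ?thesis .
qed

lemma doubly_stochastic_kernel_power:
  assumes V: "finite V" and K: "doubly_stochastic V K"
  shows "doubly_stochastic V (kernel_power V K k)"
proof (induction k)
  case 0
  show ?case using V by (simp add: doubly_stochastic_def of_bool_def)
next
  case (Suc k)
  let ?P = "kernel_power V K k"
  have "(\<Sum>w\<in>V. \<Sum>u\<in>V. K v u * ?P u w) = 1" if "v \<in> V" for v
  proof -
    have "(\<Sum>w\<in>V. \<Sum>u\<in>V. K v u * ?P u w) = (\<Sum>u\<in>V. K v u * (\<Sum>w\<in>V. ?P u w))"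
      by (subst sum.swap) (simp add: sum_distrib_left)
    then show ?thesis using K Suc that by (simp add: doubly_stochastic_def)
  qed
  moreover have "(\<Sum>v\<in>V. \<Sum>u\<in>V. K v u * ?P u w) = 1" if "w \<in> V" for w
  proof -
    have "(\<Sum>v\<in>V. \<Sum>u\<in>V. K v u * ?P u w) = (\<Sum>u\<in>V. (\<Sum>v\<in>V. K v u) * ?P u w)"
      by (subst sum.swap) (simp add: sum_distrib_right)
    then show ?thesis using K Suc that by (simp add: doubly_stochastic_def)
  qed
  ultimately show ?case using K Suc by (auto simp: doubly_stochastic_def intro!: sum_nonneg mult_nonneg_nonneg)
qed

lemma doubly_stochastic_L2_bounded:
  assumes "finite V" "doubly_stochastic V K"
  shows "L2_bounded TYPE('x::real_normed_vector) V 1 K"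
  using assms(2) by (intro L2_bounded_Schur_test assms(1)) (simp_all add: doubly_stochastic_def)

lemma sum_kernel_apply:
  assumes "doubly_stochastic V K"
  shows "(\<Sum>v\<in>V. kernel_apply V K f v) = (\<Sum>v\<in>V. f v)"
proof -
  have "(\<Sum>v\<in>V. kernel_apply V K f v) = (\<Sum>w\<in>V. (\<Sum>v\<in>V. K v w) *\<^sub>R f w)"
    unfolding kernel_apply_def by (subst sum.swap) (simp add: scaleR_sum_left)
  then show ?thesis using assms by (simp add: doubly_stochastic_def)
qed

text \<open>
  Mean zero persists under iteration because the column sums are \<open>1\<close>.
\<close>
lemma kernel_power_mean_zero:
  fixes f :: "'v \<Rightarrow> real"
  assumes V: "finite V" and K: "doubly_stochastic V K" and \<rho>: "0 \<le> \<rho>"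
    and gap: "\<And>f :: 'v \<Rightarrow> real. (\<Sum>v\<in>V. f v) = 0 \<Longrightarrow>
      (\<Sum>v\<in>V. (kernel_apply V K f v)\<^sup>2) \<le> \<rho> * (\<Sum>v\<in>V. (f v)\<^sup>2)"
    and f: "(\<Sum>v\<in>V. f v) = 0"
  shows "(\<Sum>v\<in>V. (kernel_apply V (kernel_power V K k) f v)\<^sup>2) \<le> \<rho> ^ k * (\<Sum>v\<in>V. (f v)\<^sup>2)"
proof (induction k)
  case 0
  show ?case using kernel_apply_power_0[OF V, of _ K f] by (simp del: kernel_power.simps)
next
  case (Suc k)
  let ?g = "kernel_apply V (kernel_power V K k) f"
  have "(\<Sum>v\<in>V. ?g v) = 0"
    using sum_kernel_apply[OF doubly_stochastic_kernel_power[OF V K, of k], of f] f by (rule trans)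
  then have "(\<Sum>v\<in>V. (kernel_apply V K ?g v)\<^sup>2) \<le> \<rho> * (\<Sum>v\<in>V. (?g v)\<^sup>2)" by (rule gap)
  also have "\<dots> \<le> \<rho> * (\<rho> ^ k * (\<Sum>v\<in>V. (f v)\<^sup>2))" by (rule mult_left_mono[OF Suc \<rho>])
  finally show ?case by (simp add: kernel_apply_power_Suc mult.assoc del: kernel_power.simps)
qed

text \<open>
  Let \<open>J\<close> be the kernel with all entries \<open>1 / |V|\<close>. Uniform curvature is applied to \<open>T = (K\<^sup>k - J) / 2\<close>: its real norm
  is at most \<open>\<rho>\<^bsup>k/2\<^esup>\<close>, while \<open>|T| \<le> (K\<^sup>k + J) / 2\<close> entrywise, a doubly stochastic kernel. On functions of
  mean zero \<open>K\<^sup>k = 2 T\<close>, so the bound \<open>1 / 4\<close> for \<open>T\<close> gives \<open>1 / 2\<close> for \<open>K\<^sup>k\<close>.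
\<close>
lemma uniformly_curved_kernel_power:
  assumes uc: "uniformly_curved TYPE('y::real_normed_vector)" and \<rho>: "0 \<le> \<rho>" "\<rho> < 1"
  shows "\<exists>k>0. \<forall>(V :: 'v set) K. finite V \<longrightarrow> V \<noteq> {} \<longrightarrow> doubly_stochastic V K \<longrightarrow>
    (\<forall>f :: 'v \<Rightarrow> real. (\<Sum>v\<in>V. f v) = 0 \<longrightarrow>
      (\<Sum>v\<in>V. (kernel_apply V K f v)\<^sup>2) \<le> \<rho> * (\<Sum>v\<in>V. (f v)\<^sup>2)) \<longrightarrow>
    (\<forall>f :: 'v \<Rightarrow> 'y. (\<Sum>v\<in>V. f v) = 0 \<longrightarrow>
      (\<Sum>v\<in>V. (norm (kernel_apply V (kernel_power V K k) f v))\<^sup>2) \<le> 1 / 4 * (\<Sum>v\<in>V. (norm (f v))\<^sup>2))"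
proof -
  obtain \<epsilon> where \<epsilon>: "\<epsilon> > 0" "\<And>(V :: 'v set) K. finite V \<Longrightarrow> V \<noteq> {} \<Longrightarrow> L2_bounded TYPE(real) V \<epsilon> K \<Longrightarrow>
     L2_bounded TYPE(real) V 1 (\<lambda>v w. \<bar>K v w\<bar>) \<Longrightarrow> L2_bounded TYPE('y) V (1 / 4) K"
    using uniformly_curved_L2_bounded[OF uc, of "1 / 4", where 'v='v] by auto
  obtain k0 where k0: "\<rho> ^ k0 < \<epsilon>\<^sup>2" using real_arch_pow_inv[of "\<epsilon>\<^sup>2" \<rho>] \<epsilon>(1) \<rho> by auto
  define k where "k = Suc k0"
  have "\<rho> ^ k \<le> \<rho> ^ k0" using \<rho> by (simp add: k_def mult_left_le_one_le)
  then have k: "\<rho> ^ k \<le> \<epsilon>\<^sup>2" using k0 by simp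
  show ?thesis
  proof (intro exI[of _ k] conjI allI impI)
    show "k > 0" by (simp add: k_def)
    fix V :: "'v set" and K and f :: "'v \<Rightarrow> 'y"
    assume V: "finite V" "V \<noteq> {}" and K: "doubly_stochastic V K"
      and gap: "\<forall>f :: 'v \<Rightarrow> real. (\<Sum>v\<in>V. f v) = 0 \<longrightarrow>
          (\<Sum>v\<in>V. (kernel_apply V K f v)\<^sup>2) \<le> \<rho> * (\<Sum>v\<in>V. (f v)\<^sup>2)"
      and f: "(\<Sum>v\<in>V. f v) = 0"
    let ?n = "real (card V)"
    have n: "?n > 0" using V by (simp add: card_gt_0_iff)
    let ?P = "kernel_power V K k"
    define T where "T v w = (?P v w - 1 / ?n) / 2" for v w
    have P: "doubly_stochastic V ?P" by (rule doubly_stochastic_kernel_power[OF V(1) K])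
    have Tabs: "\<bar>T v w\<bar> \<le> (?P v w + 1 / ?n) / 2" if "v \<in> V" "w \<in> V" for v w
    proof -
      have "0 \<le> ?P v w" "0 < 1 / ?n" using P n that by (auto simp: doubly_stochastic_def)
      then show ?thesis unfolding T_def by (simp add: abs_le_iff del: zero_less_divide_1_iff)
    qed
    have T1: "L2_bounded TYPE(real) V 1 (\<lambda>v w. \<bar>T v w\<bar>)"
    proof (rule L2_bounded_Schur_test[OF V(1)])
      fix v assume v: "v \<in> V"
      have "(\<Sum>w\<in>V. \<bar>T v w\<bar>) \<le> (\<Sum>w\<in>V. (?P v w + 1 / ?n) / 2)" by (intro sum_mono Tabs v)
      also have "\<dots> = 1" using P v n by (simp add: sum.distrib doubly_stochastic_def flip: sum_divide_distrib)
      finally show "(\<Sum>w\<in>V. \<bar>\<bar>T v w\<bar>\<bar>) \<le> 1" by simp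
      have "(\<Sum>w\<in>V. \<bar>T w v\<bar>) \<le> (\<Sum>w\<in>V. (?P w v + 1 / ?n) / 2)" by (intro sum_mono Tabs v)
      also have "\<dots> = 1" using P v n by (simp add: sum.distrib doubly_stochastic_def flip: sum_divide_distrib)
      finally show "(\<Sum>w\<in>V. \<bar>\<bar>T w v\<bar>\<bar>) \<le> 1" by simp
    qed
    have T\<epsilon>: "L2_bounded TYPE(real) V \<epsilon> T"
      unfolding L2_bounded_def
    proof
      fix g :: "'v \<Rightarrow> real"
      define m where "m = (\<Sum>v\<in>V. g v) / ?n"
      have m: "?n * m = (\<Sum>v\<in>V. g v)" using n by (simp add: m_def)
      have sum0: "(\<Sum>v\<in>V. g v - m) = 0" using m by (simp add: sum_subtractf)
      have T: "kernel_apply V T g v = kernel_apply V ?P (\<lambda>v. g v - m) v / 2" if "v \<in> V" for v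
      proof -
        have "kernel_apply V T g v = ((\<Sum>w\<in>V. ?P v w * g w) - (\<Sum>w\<in>V. g w) / ?n) / 2"
          by (simp add: kernel_apply_def T_def left_diff_distrib diff_divide_distrib sum_subtractf
              sum_divide_distrib)
        also have "(\<Sum>w\<in>V. g w) / ?n = (\<Sum>w\<in>V. ?P v w) * m"
          using P that by (simp add: doubly_stochastic_def m_def)
        finally show ?thesis
          by (simp add: kernel_apply_def right_diff_distrib sum_subtractf sum_distrib_right)
      qed
      have var: "(\<Sum>v\<in>V. (g v - m)\<^sup>2) \<le> (\<Sum>v\<in>V. (g v)\<^sup>2)"
      proof -
        have "(\<Sum>v\<in>V. (g v - m)\<^sup>2) = (\<Sum>v\<in>V. (g v)\<^sup>2 - 2 * m * g v + m\<^sup>2)"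
          by (intro sum.cong) (auto simp: power2_diff)
        also have "\<dots> = (\<Sum>v\<in>V. (g v)\<^sup>2) - 2 * m * (\<Sum>v\<in>V. g v) + ?n * m\<^sup>2"
          by (simp only: sum.distrib sum_subtractf sum_distrib_left[symmetric] sum_constant)
        also have "\<dots> = (\<Sum>v\<in>V. (g v)\<^sup>2) - ?n * m\<^sup>2"
          unfolding m[symmetric] by (simp add: power2_eq_square)
        also have "\<dots> \<le> (\<Sum>v\<in>V. (g v)\<^sup>2)" by simp
        finally show ?thesis .
      qed
      have "(\<Sum>v\<in>V. (norm (kernel_apply V T g v))\<^sup>2) = (\<Sum>v\<in>V. (kernel_apply V ?P (\<lambda>v. g v - m) v)\<^sup>2) / 4"
        unfolding sum_divide_distrib by (intro sum.cong refl) (simp add: T power_divide)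
      also have "\<dots> \<le> (\<Sum>v\<in>V. (kernel_apply V ?P (\<lambda>v. g v - m) v)\<^sup>2)"
        by (simp add: sum_nonneg)
      also have "\<dots> \<le> \<rho> ^ k * (\<Sum>v\<in>V. (g v - m)\<^sup>2)"
        using gap by (intro kernel_power_mean_zero[OF V(1) K \<rho>(1) _ sum0]) blast
      also have "\<dots> \<le> \<epsilon>\<^sup>2 * (\<Sum>v\<in>V. (g v)\<^sup>2)"
        using k var by (intro mult_mono sum_nonneg) auto
      finally show "(\<Sum>v\<in>V. (norm (kernel_apply V T g v))\<^sup>2) \<le> \<epsilon>\<^sup>2 * (\<Sum>v\<in>V. (norm (g v))\<^sup>2)" by simp
    qed
    have C: "L2_bounded TYPE('y) V (1 / 4) T" by (rule \<epsilon>(2)[OF V T\<epsilon> T1])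
    have "kernel_apply V ?P f v = 2 *\<^sub>R kernel_apply V T f v" for v
    proof -
      have twice: "2 * T v w = ?P v w - 1 / ?n" for w unfolding T_def mult_2 by (rule field_sum_of_halves)
      have "2 *\<^sub>R kernel_apply V T f v = (\<Sum>w\<in>V. (2 * T v w) *\<^sub>R f w)"
        by (simp add: kernel_apply_def scaleR_sum_right)
      also have "\<dots> = (\<Sum>w\<in>V. ?P v w *\<^sub>R f w) - (1 / ?n) *\<^sub>R (\<Sum>w\<in>V. f w)"
        unfolding twice by (simp add: scaleR_sum_right scaleR_diff_left sum_subtractf)
      finally have "2 *\<^sub>R kernel_apply V T f v = (\<Sum>w\<in>V. ?P v w *\<^sub>R f w) - (1 / ?n) *\<^sub>R (\<Sum>w\<in>V. f w)" .
      then show ?thesis using f by (simp add: kernel_apply_def)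
    qed
    then have "(\<Sum>v\<in>V. (norm (kernel_apply V ?P f v))\<^sup>2) = 4 * (\<Sum>v\<in>V. (norm (kernel_apply V T f v))\<^sup>2)"
      by (simp add: power_mult_distrib sum_distrib_left)
    also have "\<dots> \<le> 4 * ((1 / 4)\<^sup>2 * (\<Sum>v\<in>V. (norm (f v))\<^sup>2))"
      using C unfolding L2_bounded_def by (intro mult_left_mono) auto
    finally show "(\<Sum>v\<in>V. (norm (kernel_apply V ?P f v))\<^sup>2) \<le> 1 / 4 * (\<Sum>v\<in>V. (norm (f v))\<^sup>2)"
      by (simp add: power2_eq_square)
  qed
qed

section \<open>Lazy random walks on graphs\<close>

text \<open>
  The matrix \<open>I - L / (2 D)\<close>. Dividing by the common bound \<open>D\<close> instead of the degree of each vertex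
  keeps the matrix symmetric for irregular graphs; the factor \<open>2\<close> keeps its spectrum away
  from \<open>-1\<close>, so that bipartite graphs cause no trouble.
\<close>
definition lazy_walk :: "nat \<Rightarrow> ('v, 'e) pre_digraph \<Rightarrow> 'v \<Rightarrow> 'v \<Rightarrow> real" where
  "lazy_walk D G v w =
     (if v = w then 1 - card (out_arcs G v) / (2 * D) else 0) + card {e \<in> out_arcs G v. head G e = w} / (2 * D)"

lemma kernel_apply_lazy_walk:
  fixes f :: "'v \<Rightarrow> 'x::real_vector"
  assumes G: "finite_connected_graph G" and v: "v \<in> verts G"
  shows "kernel_apply (verts G) (lazy_walk D G) f v
    = f v - (1 / (2 * D)) *\<^sub>R (\<Sum>e\<in>out_arcs G v. f v - f (head G e))"
proof -
  note fin = finite_connected_graphD[OF G]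
  let ?V = "verts G" and ?d = "card (out_arcs G v)"
  have fo: "finite (out_arcs G v)" using fin(2) by (simp add: out_arcs_def)
  have "kernel_apply ?V (lazy_walk D G) f v
      = (\<Sum>w\<in>?V. if v = w then (1 - ?d / (2 * D)) *\<^sub>R f w else 0)
      + (\<Sum>w\<in>?V. (card {e \<in> out_arcs G v. head G e = w} / (2 * D)) *\<^sub>R f w)"
    unfolding kernel_apply_def sum.distrib[symmetric]
    by (intro sum.cong refl) (auto simp: lazy_walk_def scaleR_add_left)
  also have "(\<Sum>w\<in>?V. if v = w then (1 - ?d / (2 * D)) *\<^sub>R f w else 0) = (1 - ?d / (2 * D)) *\<^sub>R f v"
    using v fin by simp
  also have "(\<Sum>w\<in>?V. (card {e \<in> out_arcs G v. head G e = w} / (2 * D)) *\<^sub>R f w)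
      = (1 / (2 * D)) *\<^sub>R (\<Sum>w\<in>?V. \<Sum>e\<in>{e \<in> out_arcs G v. head G e = w}. f (head G e))"
    by (simp add: scaleR_sum_right sum_constant_scaleR)
  also have "(\<Sum>w\<in>?V. \<Sum>e\<in>{e \<in> out_arcs G v. head G e = w}. f (head G e)) = (\<Sum>e\<in>out_arcs G v. f (head G e))"
    by (rule sum.group) (use fin fo in auto)
  finally show ?thesis
    by (simp add: sum_subtractf sum_constant_scaleR scaleR_diff_left scaleR_diff_right)
qed

lemma lazy_walk_commute:
  assumes G: "finite_connected_graph G"
  shows "lazy_walk D G v w = lazy_walk D G w v"
proof -
  note fin = finite_connected_graphD[OF G]
  have count: "card {e \<in> out_arcs G v. head G e = w}
      = (\<Sum>e\<in>arcs G. if tail G e = v \<and> head G e = w then 1 else 0)" for v w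
  proof -
    have "{e \<in> out_arcs G v. head G e = w} = {e \<in> arcs G. tail G e = v \<and> head G e = w}"
      by (auto simp: out_arcs_def)
    then show ?thesis using sum.inter_filter[OF fin(2), of "\<lambda>_. 1 :: nat"] by (simp only: card_eq_sum)
  qed
  have "card {e \<in> out_arcs G v. head G e = w} = (\<Sum>e\<in>arcs G. if head G e = v \<and> tail G e = w then 1 else 0)"
    unfolding count by (rule sum_arcs_reverse[OF G, of "\<lambda>a b. if a = v \<and> b = w then 1 else 0"])
  also have "\<dots> = card {e \<in> out_arcs G w. head G e = v}"
    unfolding count by (intro sum.cong) auto
  finally have "card {e \<in> out_arcs G v. head G e = w} = card {e \<in> out_arcs G w. head G e = v}" .
  then show ?thesis by (simp add: lazy_walk_def)
qed

lemma doubly_stochastic_lazy_walk: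
  assumes G: "finite_connected_graph G" and D: "max_degree G \<le> D" "D > 0"
  shows "doubly_stochastic (verts G) (lazy_walk D G)"
proof -
  have row: "(\<Sum>w\<in>verts G. lazy_walk D G v w) = 1" if "v \<in> verts G" for v
    using kernel_apply_lazy_walk[OF G that, of D "\<lambda>_. 1 :: real"] by (simp add: kernel_apply_def)
  have col: "(\<Sum>v\<in>verts G. lazy_walk D G v w) = 1" if "w \<in> verts G" for w
    using row[OF that] by (subst lazy_walk_commute[OF G])
  have "0 \<le> lazy_walk D G v w" if "v \<in> verts G" for v w
    using card_out_arcs_le[OF G D(1) that] D(2) by (auto simp: lazy_walk_def intro!: add_nonneg_nonneg)
  then show ?thesis using row col by (simp add: doubly_stochastic_def)
qed

lemma laplacian_square_le:
  fixes f :: "'v \<Rightarrow> 'x::real_normed_vector"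
  assumes G: "finite_connected_graph G" and D: "max_degree G \<le> D"
  shows "(\<Sum>v\<in>verts G. (norm (\<Sum>e\<in>out_arcs G v. f v - f (head G e)))\<^sup>2)
    \<le> D * (\<Sum>e\<in>arcs G. (norm (f (head G e) - f (tail G e)))\<^sup>2)"
proof -
  have "(norm (\<Sum>e\<in>out_arcs G v. f v - f (head G e)))\<^sup>2
      \<le> D * (\<Sum>e\<in>out_arcs G v. (norm (f (head G e) - f v))\<^sup>2)" if v: "v \<in> verts G" for v
  proof -
    have "(norm (\<Sum>e\<in>out_arcs G v. f v - f (head G e)))\<^sup>2 \<le> (\<Sum>e\<in>out_arcs G v. norm (f (head G e) - f v))\<^sup>2"
      using norm_sum[of "\<lambda>e. f v - f (head G e)" "out_arcs G v"]
      by (intro power_mono) (simp_all add: norm_minus_commute)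
    also have "\<dots> \<le> (\<Sum>e\<in>out_arcs G v. (norm (f (head G e) - f v))\<^sup>2) * card (out_arcs G v)"
      by (rule sum_squared_le_sum_of_squares)
    also have "\<dots> \<le> (\<Sum>e\<in>out_arcs G v. (norm (f (head G e) - f v))\<^sup>2) * D"
      using card_out_arcs_le[OF G D v] by (intro mult_left_mono sum_nonneg) auto
    finally show ?thesis by (simp add: mult.commute)
  qed
  then have "(\<Sum>v\<in>verts G. (norm (\<Sum>e\<in>out_arcs G v. f v - f (head G e)))\<^sup>2)
      \<le> (\<Sum>v\<in>verts G. D * (\<Sum>e\<in>out_arcs G v. (norm (f (head G e) - f v))\<^sup>2))"
    by (rule sum_mono)
  also have "\<dots> = D * (\<Sum>e\<in>arcs G. (norm (f (head G e) - f (tail G e)))\<^sup>2)"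
    using sum_out_arcs[OF G, of "\<lambda>v e. (norm (f (head G e) - f v))\<^sup>2"]
    by (simp flip: sum_distrib_left)
  finally show ?thesis .
qed

lemma poincare_2_iff:
  "poincare TYPE('x::real_normed_vector) 2 c (G :: ('v, 'e) pre_digraph) \<longleftrightarrow> (\<forall>f :: 'v \<Rightarrow> 'x.
     c * (\<Sum>v\<in>verts G. (norm (f v - graph_mean G f))\<^sup>2) \<le> (\<Sum>e\<in>arcs G. (norm (f (head G e) - f (tail G e)))\<^sup>2))"
  by (simp add: poincare_def)

text \<open>
  Let \<open>E\<close> be the energy of \<open>f\<close>. Then \<open>\<langle>f, L f\<rangle> = E / 2\<close> and \<open>\<parallel>L f\<parallel>\<^sup>2 \<le> D E\<close>, so expanding the square gives
  \<open>\<parallel>A f\<parallel>\<^sup>2 \<le> \<parallel>f\<parallel>\<^sup>2 - E / (4 D)\<close>; no eigenvalues are needed.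
\<close>
lemma lazy_walk_gap:
  fixes f :: "'v \<Rightarrow> real"
  assumes G: "finite_connected_graph G" and D: "max_degree G \<le> D" "D > 0"
    and P: "poincare TYPE(real) 2 c G" and f: "(\<Sum>v\<in>verts G. f v) = 0"
  shows "(\<Sum>v\<in>verts G. (kernel_apply (verts G) (lazy_walk D G) f v)\<^sup>2) \<le> (1 - c / (4 * D)) * (\<Sum>v\<in>verts G. (f v)\<^sup>2)"
proof -
  let ?V = "verts G"
  define L where "L v = (\<Sum>e\<in>out_arcs G v. f v - f (head G e))" for v
  define E where "E = (\<Sum>e\<in>arcs G. (f (head G e) - f (tail G e))\<^sup>2)"
  have "(\<Sum>v\<in>?V. f v * L v) = (\<Sum>e\<in>arcs G. f (tail G e) * (f (tail G e) - f (head G e)))"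
    using sum_out_arcs[OF G, of "\<lambda>v e. f v * (f v - f (head G e))"] by (simp add: L_def sum_distrib_left)
  moreover have "(\<Sum>e\<in>arcs G. f (tail G e) * (f (tail G e) - f (head G e)))
      = (\<Sum>e\<in>arcs G. f (head G e) * (f (head G e) - f (tail G e)))"
    by (rule sum_arcs_reverse[OF G, of "\<lambda>a b. f a * (f a - f b)"])
  moreover have "E = (\<Sum>e\<in>arcs G. f (tail G e) * (f (tail G e) - f (head G e)))
      + (\<Sum>e\<in>arcs G. f (head G e) * (f (head G e) - f (tail G e)))"
    unfolding E_def sum.distrib[symmetric] by (intro sum.cong refl) (simp add: power2_eq_square algebra_simps)
  ultimately have dirichlet: "2 * (\<Sum>v\<in>?V. f v * L v) = E" by simp
  have L2: "(\<Sum>v\<in>?V. (L v)\<^sup>2) \<le> D * E"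
    using laplacian_square_le[OF G D(1), of f] by (simp add: L_def E_def)
  have "graph_mean G f = 0" using f by (simp add: graph_mean_def)
  then have gap: "c * (\<Sum>v\<in>?V. (f v)\<^sup>2) \<le> E"
    using P[unfolded poincare_2_iff, rule_format, of f] by (simp add: E_def)
  have "(\<Sum>v\<in>?V. (kernel_apply ?V (lazy_walk D G) f v)\<^sup>2)
      = (\<Sum>v\<in>?V. (f v)\<^sup>2 - (1 / D) * (f v * L v) + (1 / (4 * D\<^sup>2)) * (L v)\<^sup>2)"
    by (intro sum.cong refl)
      (simp add: kernel_apply_lazy_walk[OF G] power2_diff power_divide power_mult_distrib flip: L_def)
  also have "\<dots> = (\<Sum>v\<in>?V. (f v)\<^sup>2) - (1 / D) * (\<Sum>v\<in>?V. f v * L v) + (1 / (4 * D\<^sup>2)) * (\<Sum>v\<in>?V. (L v)\<^sup>2)"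
    by (simp only: sum.distrib sum_subtractf sum_distrib_left)
  also have "\<dots> \<le> (\<Sum>v\<in>?V. (f v)\<^sup>2) - (1 / D) * (E / 2) + (1 / (4 * D\<^sup>2)) * (D * E)"
    using dirichlet L2 by (intro add_mono diff_mono mult_left_mono) auto
  also have "\<dots> = (\<Sum>v\<in>?V. (f v)\<^sup>2) - E / (4 * D)"
    using D(2) by (simp add: field_simps power2_eq_square)
  also have "\<dots> \<le> (\<Sum>v\<in>?V. (f v)\<^sup>2) - c * (\<Sum>v\<in>?V. (f v)\<^sup>2) / (4 * D)"
    using gap by (intro diff_mono divide_right_mono) auto
  finally show ?thesis by (simp add: algebra_simps)
qed

text \<open>
  Telescoping: \<open>f - K\<^bsup>k+1\<^esup> f = (f - K f) + K (f - K\<^sup>k f)\<close>, and \<open>K\<close> is a contraction on \<open>L\<^sub>2(V, X)\<close>.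
\<close>
lemma norm_kernel_power_diff_le:
  fixes f :: "'v \<Rightarrow> 'x::real_normed_vector"
  assumes V: "finite V" and K: "doubly_stochastic V K"
  shows "L2_set (\<lambda>v. norm (f v - kernel_apply V (kernel_power V K k) f v)) V
    \<le> k * L2_set (\<lambda>v. norm (f v - kernel_apply V K f v)) V"
proof (induction k)
  case 0
  have "L2_set (\<lambda>v. norm (f v - kernel_apply V (kernel_power V K 0) f v)) V = 0"
    using kernel_apply_power_0[OF V, of _ K f] by (intro L2_set_0' ballI) (simp del: kernel_power.simps)
  then show ?case by (simp del: kernel_power.simps)
next
  case (Suc k)
  let ?A = "kernel_apply V K" and ?A\<^sub>k = "kernel_apply V (kernel_power V K k)"
  define g where "g v = f v - ?A\<^sub>k f v" for v
  have "L2_set (\<lambda>v. norm (?A g v)) V \<le> L2_set (\<lambda>v. norm (g v)) V"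
    using doubly_stochastic_L2_bounded[OF V K, where 'x='x] unfolding L2_bounded_def L2_set_def by simp
  moreover have "norm (f v - kernel_apply V (kernel_power V K (Suc k)) f v) \<le> norm (f v - ?A f v) + norm (?A g v)" for v
  proof -
    have "f v - kernel_apply V (kernel_power V K (Suc k)) f v = (f v - ?A f v) + ?A g v"
      unfolding kernel_apply_power_Suc
      by (simp add: kernel_apply_def[of V K] g_def scaleR_diff_right sum_subtractf)
    then show ?thesis by (simp only: norm_triangle_ineq)
  qed
  then have "L2_set (\<lambda>v. norm (f v - kernel_apply V (kernel_power V K (Suc k)) f v)) V
      \<le> L2_set (\<lambda>v. norm (f v - ?A f v)) V + L2_set (\<lambda>v. norm (?A g v)) V"
    by (intro order_trans[OF L2_set_mono L2_set_triangle_ineq]) auto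
  ultimately show ?case using Suc unfolding g_def by (simp add: algebra_simps del: kernel_power.simps)
qed

lemma uniformly_curved_poincare:
  assumes uc: "uniformly_curved TYPE('y::real_normed_vector)" and c: "c > 0" and D: "D > 0"
  shows "\<exists>c'>0. \<forall>G :: ('v, 'e) pre_digraph. finite_connected_graph G \<longrightarrow> max_degree G \<le> D \<longrightarrow>
    poincare TYPE(real) 2 c G \<longrightarrow> poincare TYPE('y) 2 c' G"
proof -
  \<comment> \<open>truncated at \<open>0\<close>, since nothing bounds \<open>c\<close> above here\<close>
  define \<rho> where "\<rho> = max 0 (1 - c / (4 * real D))"
  have \<rho>: "0 \<le> \<rho>" "\<rho> < 1" using c D by (auto simp: \<rho>_def)
  obtain k where k: "k > 0" and main: "\<forall>(V :: 'v set) K. finite V \<longrightarrow> V \<noteq> {} \<longrightarrow> doubly_stochastic V K \<longrightarrow>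
    (\<forall>f :: 'v \<Rightarrow> real. (\<Sum>v\<in>V. f v) = 0 \<longrightarrow>
      (\<Sum>v\<in>V. (kernel_apply V K f v)\<^sup>2) \<le> \<rho> * (\<Sum>v\<in>V. (f v)\<^sup>2)) \<longrightarrow>
    (\<forall>f :: 'v \<Rightarrow> 'y. (\<Sum>v\<in>V. f v) = 0 \<longrightarrow>
      (\<Sum>v\<in>V. (norm (kernel_apply V (kernel_power V K k) f v))\<^sup>2) \<le> 1 / 4 * (\<Sum>v\<in>V. (norm (f v))\<^sup>2))"
    using uniformly_curved_kernel_power[OF uc \<rho>, where 'v='v] by (elim exE conjE) (rule that)
  show ?thesis
  proof (intro exI[of _ "D / (real k)\<^sup>2"] conjI allI impI)
    show "0 < D / (real k)\<^sup>2" using D k by simp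
    fix G :: "('v, 'e) pre_digraph"
    assume G: "finite_connected_graph G" and deg: "max_degree G \<le> D" and P: "poincare TYPE(real) 2 c G"
    note fin = finite_connected_graphD[OF G]
    let ?V = "verts G" and ?K = "lazy_walk D G"
    let ?A = "kernel_apply ?V ?K" and ?P = "kernel_apply ?V (kernel_power ?V ?K k)"
    have K: "doubly_stochastic ?V ?K" by (rule doubly_stochastic_lazy_walk[OF G deg D])
    have gap: "\<forall>f :: 'v \<Rightarrow> real. (\<Sum>v\<in>?V. f v) = 0 \<longrightarrow> (\<Sum>v\<in>?V. (?A f v)\<^sup>2) \<le> \<rho> * (\<Sum>v\<in>?V. (f v)\<^sup>2)"
    proof (intro allI impI)
      fix f :: "'v \<Rightarrow> real" assume "(\<Sum>v\<in>?V. f v) = 0"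
      then have "(\<Sum>v\<in>?V. (?A f v)\<^sup>2) \<le> (1 - c / (4 * D)) * (\<Sum>v\<in>?V. (f v)\<^sup>2)"
        by (rule lazy_walk_gap[OF G deg D P])
      also have "\<dots> \<le> \<rho> * (\<Sum>v\<in>?V. (f v)\<^sup>2)"
        by (intro mult_right_mono sum_nonneg) (auto simp: \<rho>_def)
      finally show "(\<Sum>v\<in>?V. (?A f v)\<^sup>2) \<le> \<rho> * (\<Sum>v\<in>?V. (f v)\<^sup>2)" .
    qed
    have half: "(\<Sum>v\<in>?V. (norm (?P f v))\<^sup>2) \<le> 1 / 4 * (\<Sum>v\<in>?V. (norm (f v))\<^sup>2)"
      if "(\<Sum>v\<in>?V. f v) = 0" for f :: "'v \<Rightarrow> 'y"
      by (rule main[rule_format, OF fin(1,3) K _ that]) (rule gap[rule_format])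
    show "poincare TYPE('y) 2 (D / (real k)\<^sup>2) G"
      unfolding poincare_2_iff
    proof
      fix f0 :: "'v \<Rightarrow> 'y"
      define f where "f v = f0 v - graph_mean G f0" for v
      define E where "E = (\<Sum>e\<in>arcs G. (norm (f (head G e) - f (tail G e)))\<^sup>2)"
      have "graph_mean G f = 0"
        using graph_mean_diff[OF G, of f0 "graph_mean G f0"] by (simp add: f_def[abs_def])
      then have sum0: "(\<Sum>v\<in>?V. f v) = 0" using fin(1,3) by (simp add: graph_mean_def)
      define N where "N g = L2_set (\<lambda>v. norm (g v)) ?V" for g :: "'v \<Rightarrow> 'y"
      have "(N (\<lambda>v. f v - ?A f v))\<^sup>2 = (\<Sum>v\<in>?V. (norm (\<Sum>e\<in>out_arcs G v. f v - f (head G e)))\<^sup>2) / (4 * (real D)\<^sup>2)"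
        unfolding N_def L2_set_def sum_divide_distrib
        by (subst real_sqrt_pow2) (auto simp: kernel_apply_lazy_walk[OF G] power_divide power_mult_distrib intro!: sum_nonneg)
      also have "\<dots> \<le> D * E / (4 * (real D)\<^sup>2)"
        using laplacian_square_le[OF G deg, of f] by (intro divide_right_mono) (auto simp: E_def)
      also have "\<dots> = E / (4 * D)" using D by (simp add: power2_eq_square)
      finally have step: "(N (\<lambda>v. f v - ?A f v))\<^sup>2 \<le> E / (4 * D)" .
      have "N (?P f) \<le> sqrt (1 / 4 * (\<Sum>v\<in>?V. (norm (f v))\<^sup>2))"
        unfolding N_def L2_set_def by (intro real_sqrt_le_mono half sum0)
      also have "\<dots> = sqrt (1 / 4) * N f" unfolding N_def L2_set_def by (rule real_sqrt_mult)
      also have "sqrt (1 / 4) = 1 / (2::real)" by (simp add: real_sqrt_divide)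
      finally have half': "N (?P f) \<le> N f / 2" by simp
      have "N f \<le> L2_set (\<lambda>v. norm (f v - ?P f v) + norm (?P f v)) ?V"
        unfolding N_def by (intro L2_set_mono) (auto intro: norm_triangle_sub simp: add.commute)
      also have "\<dots> \<le> N (\<lambda>v. f v - ?P f v) + N (?P f)"
        unfolding N_def by (rule L2_set_triangle_ineq)
      also have "N (\<lambda>v. f v - ?P f v) \<le> k * N (\<lambda>v. f v - ?A f v)"
        unfolding N_def by (rule norm_kernel_power_diff_le[OF fin(1) K])
      finally have "N f \<le> 2 * k * N (\<lambda>v. f v - ?A f v)" using half' by simp
      then have "(N f)\<^sup>2 \<le> (2 * k * N (\<lambda>v. f v - ?A f v))\<^sup>2"
        by (intro power_mono) (auto simp: N_def)
      also have "\<dots> = 4 * (real k)\<^sup>2 * (N (\<lambda>v. f v - ?A f v))\<^sup>2" by (simp add: power_mult_distrib)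
      also have "\<dots> \<le> 4 * (real k)\<^sup>2 * (E / (4 * D))" by (intro mult_left_mono step) auto
      finally have "(N f)\<^sup>2 \<le> (real k)\<^sup>2 / D * E" using D by simp
      then have "D / (real k)\<^sup>2 * (N f)\<^sup>2 \<le> E" using D k by (simp add: field_simps)
      moreover have "(N f)\<^sup>2 = (\<Sum>v\<in>?V. (norm (f0 v - graph_mean G f0))\<^sup>2)"
        unfolding N_def L2_set_def by (subst real_sqrt_pow2) (auto simp: f_def intro!: sum_nonneg)
      moreover have "E = (\<Sum>e\<in>arcs G. (norm (f0 (head G e) - f0 (tail G e)))\<^sup>2)"
        by (simp add: E_def f_def)
      ultimately show "D / (real k)\<^sup>2 * (\<Sum>v\<in>?V. (norm (f0 v - graph_mean G f0))\<^sup>2)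
          \<le> (\<Sum>e\<in>arcs G. (norm (f0 (head G e) - f0 (tail G e)))\<^sup>2)"
        by simp
    qed
  qed
qed

section \<open>Hilbert space\<close>

text \<open>
  For exponent 2 both sides of the inequality are sums over the coordinates, so it holds with the same
  constant.
\<close>
lemma poincare_2_coordinates:
  fixes \<pi> :: "nat \<Rightarrow> 'x::real_normed_vector \<Rightarrow> 'z::real_normed_vector"
  assumes lin: "\<And>k. linear (\<pi> k)" and sums: "\<And>x. (\<lambda>k. (norm (\<pi> k x))\<^sup>2) sums (norm x)\<^sup>2"
    and P: "poincare TYPE('z) 2 c (G :: ('v, 'e) pre_digraph)"
  shows "poincare TYPE('x) 2 c G"
  unfolding poincare_2_iff
proof
  fix f :: "'v \<Rightarrow> 'x"
  let ?f = "\<lambda>k v. \<pi> k (f v)"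
  have mean: "\<pi> k (graph_mean G f) = graph_mean G (?f k)" for k
    by (simp add: graph_mean_def linear_scale[OF lin] linear_sum[OF lin])
  have var: "(\<lambda>k. c * (\<Sum>v\<in>verts G. (norm (\<pi> k (f v - graph_mean G f)))\<^sup>2))
      sums (c * (\<Sum>v\<in>verts G. (norm (f v - graph_mean G f))\<^sup>2))"
    by (intro sums_mult sums_sum sums)
  have energy: "(\<lambda>k. \<Sum>e\<in>arcs G. (norm (\<pi> k (f (head G e) - f (tail G e))))\<^sup>2)
      sums (\<Sum>e\<in>arcs G. (norm (f (head G e) - f (tail G e)))\<^sup>2)"
    by (intro sums_sum sums)
  have le: "c * (\<Sum>v\<in>verts G. (norm (\<pi> k (f v - graph_mean G f)))\<^sup>2)
      \<le> (\<Sum>e\<in>arcs G. (norm (\<pi> k (f (head G e) - f (tail G e))))\<^sup>2)" for k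
    using P[unfolded poincare_2_iff, rule_format, of "?f k"] by (simp add: linear_diff[OF lin] mean)
  show "c * (\<Sum>v\<in>verts G. (norm (f v - graph_mean G f))\<^sup>2)
      \<le> (\<Sum>e\<in>arcs G. (norm (f (head G e) - f (tail G e)))\<^sup>2)"
    by (rule sums_le[OF le var energy])
qed

lemma poincare_2_complex:
  assumes "poincare TYPE(real) 2 c G"
  shows "poincare TYPE(complex) 2 c G"
proof (rule poincare_2_coordinates[OF _ _ assms])
  define \<pi> where "\<pi> k = (if k = 0 then Re else if k = 1 then Im else (\<lambda>_. 0))" for k :: nat
  show "linear (\<pi> k)" for k
    by (rule linearI) (auto simp: \<pi>_def)
  show "(\<lambda>k. (norm (\<pi> k z))\<^sup>2) sums (norm z)\<^sup>2" for z
    using sums_finite[of "{0, 1}" "\<lambda>k. (norm (\<pi> k z))\<^sup>2"] by (simp add: \<pi>_def cmod_power2)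
qed

lemma poincare_2_ell2:
  assumes "poincare TYPE(real) 2 c G"
  shows "poincare TYPE(ell2) 2 c G"
proof (rule poincare_2_coordinates[OF _ _ poincare_2_complex[OF assms]])
  show "linear (\<lambda>x. ell2_nth x k)" for k by (rule linearI) auto
  show "(\<lambda>k. (norm (ell2_nth x k))\<^sup>2) sums (norm x)\<^sup>2" for x
    using summable_sums[OF ell2_summable[of x]] by (simp add: norm_ell2_def suminf_nonneg ell2_summable)
qed

section \<open>Expanders are anders\<close>

theorem corollaryC:
  fixes G :: "nat \<Rightarrow> ('v, 'e) pre_digraph"
  assumes "anders TYPE(real) 2 G"
    and "(UNIV :: 'x::banach set) \<noteq> {0}"
  shows "((UNIV :: 'y::banach set) \<noteq> {0} \<and> uniformly_curved TYPE('y) \<and>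
            sphere_equivalent TYPE('x) TYPE('y) \<longrightarrow> (\<forall>p>1. anders TYPE('x) p G)) \<and>
         (sphere_equivalent TYPE('x) TYPE(ell2) \<longrightarrow> anders TYPE('x) 1 G)"
proof -
  have "(1::real) \<notin> {0}" by simp
  then have "(UNIV :: real set) \<noteq> {0}" by blast
  note real = assms(1)[unfolded anders_iff[OF this]]
  then have G: "finite_connected_graph (G n)" for n by blast
  obtain D0 where D0: "max_degree (G n) \<le> D0" for n using real by (auto simp: bdd_above_def)
  \<comment> \<open>a positive degree bound, as required for dividing by it\<close>
  define D where "D = Suc D0"
  have D: "max_degree (G n) \<le> D" "D > 0" for n using D0[of n] by (auto simp: D_def)
  obtain c where c: "c > 0" "\<And>n. poincare TYPE(real) 2 c (G n)" using real by blast
  have anders: "anders TYPE('x) p G"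
    if eq: "sphere_equivalent TYPE('x) TYPE('z::real_normed_vector)" and p: "p \<ge> 1"
      and c': "c' > 0" "\<And>n. poincare TYPE('z) 2 c' (G n)" for p c'
  proof -
    have "1 \<le> (2::real)" by simp
    from sphere_equivalent_poincare[OF eq p this c'(1), where D=D and 'v='v and 'e='e]
    obtain c'' where "c'' > 0" and transfer: "\<forall>G :: ('v, 'e) pre_digraph. finite_connected_graph G \<longrightarrow>
        max_degree G \<le> D \<longrightarrow> poincare TYPE('z) 2 c' G \<longrightarrow> poincare TYPE('x) p c'' G"
      by (elim exE conjE) (rule that)
    have "\<forall>n. poincare TYPE('x) p c'' (G n)"
      by (intro allI transfer[rule_format] G D c'(2))
    then have "\<exists>c>0. \<forall>n. poincare TYPE('x) p c (G n)" using \<open>c'' > 0\<close> by (intro exI conjI)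
    then show ?thesis using real by (simp add: anders_iff[OF assms(2)])
  qed
  show ?thesis
  proof (intro conjI impI allI)
    fix p :: real
    assume y: "(UNIV :: 'y set) \<noteq> {0} \<and> uniformly_curved TYPE('y) \<and> sphere_equivalent TYPE('x) TYPE('y)"
      and p: "1 < p"
    then have uc: "uniformly_curved TYPE('y)" and eq: "sphere_equivalent TYPE('x) TYPE('y)" by simp_all
    from uniformly_curved_poincare[OF uc c(1) D(2), where 'v='v and 'e='e]
    obtain c' where "c' > 0" and curved: "\<forall>G :: ('v, 'e) pre_digraph. finite_connected_graph G \<longrightarrow>
        max_degree G \<le> D \<longrightarrow> poincare TYPE(real) 2 c G \<longrightarrow> poincare TYPE('y) 2 c' G"
      by (elim exE conjE) (rule that)
    show "anders TYPE('x) p G"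
    proof (rule anders[OF eq _ \<open>c' > 0\<close>])
      show "1 \<le> p" using p by simp
      show "poincare TYPE('y) 2 c' (G n)" for n
        by (intro curved[rule_format] G D c(2))
    qed
  next
    assume eq: "sphere_equivalent TYPE('x) TYPE(ell2)"
    show "anders TYPE('x) 1 G"
      by (rule anders[OF eq order_refl c(1) poincare_2_ell2[OF c(2)]])
  qed
qed

end
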